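(* The double presheaf 2-monad $\mathbb{P}\mathbb{P}^{\dag}=(\mathsf{P}\mathsf{P}^{\dag},\mathfrak{y},\mathfrak{s})$ on $\mathcal{Q}\text{-}\mathbf{Cat}$ distributes flatly over the presheaf 2-monad $\mathbb{P}$ by $\Lambda$ with $$\Lambda_X=\overleftarrow{((\mathsf{y}_X)_{\text{!`}\,!})_*}=((\mathsf{y}_X)_{\text{!`}\,!})^!\cdot\mathsf{y}_{\mathsf{P}\mathsf{P}^{\dag}\mathsf{P}X}=\mathsf{y}_{\mathsf{P}\mathsf{P}^{\dag}X}\cdot((\mathsf{y}_X)_{\text{!`}})^!:\mathsf{P}\mathsf{P}^{\dag}\mathsf{P}X\to\mathsf{P}\mathsf{P}\mathsf{P}^{\dag}X ;$$ that is, the family $(\Lambda_X)_X$, $X$ ranging over all $\mathcal{Q}$-categories, is a flat distributive law of $\mathbb{P}\mathbb{P}^{\dag}$ over $\mathbb{P}$.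
   Context: Basic conventions. $\mathcal{Q}$ is a small quantaloid: a small category whose hom-sets are complete lattices (order $\preceq$) and whose composition preserves arbitrary suprema in each variable; $\mathcal{Q}_0$ is its object set. For $u:r\to s$, $v:s\to t$, $w:r\to t$ in $\mathcal{Q}$, the arrows $v\searrow w:r\to s$ and $w\swarrow u:s\to t$ are defined by $u\preceq v\searrow w\iff v\circ u\preceq w\iff v\preceq w\swarrow u$. For sets $X,Y$ equipped with type maps $|\text{-}|$ to $\mathcal{Q}_0$, a $\mathcal{Q}$-relation $\phi:X\nrightarrow Y$ assigns to each $(x,y)$ a morphism $\phi(x,y):|x|\to|y|$ of $\mathcal{Q}$; these are ordered pointwise by $\preceq$ and composed by $(\psi\circ\phi)(x,z)=\bigvee_y\psi(y,z)\circ\phi(x,y)$. A $\mathcal{Q}$-category is a set $X$ over $\mathcal{Q}_0$ with a $\mathcal{Q}$-relation $1_X^*:X\nrightarrow X$ (its hom) such that $1_{|x|}\preceq 1_X^*(x,x)$ and $1_X^*\circ 1_X^*\preceq 1_X^*$; it is preordered by $x\leq x'\iff |x|=|x'|$ and $1_{|x|}\preceq 1_X^*(x,x')$. A $\mathcal{Q}$-functor $f:X\to Y$ is a type-preserving map with $1_X^*(x,x')\preceq 1_Y^*(fx,fx')$; $f\leq g$ is pointwise. This gives the locally preordered 2-category $\mathcal{Q}\text{-}\mathbf{Cat}$. A 2-functor on it is a functor that is monotone on homs; a 2-monad $(T,m,e)$ is a monad whose functor $T$ is a 2-functor (multiplication $m:TT\to T$, unit $e:1\to T$). A distributor $\phi:X\nrightarrow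 Y$ is a $\mathcal{Q}$-relation with $1_Y^*\circ\phi\circ 1_X^*\preceq\phi$. For a $\mathcal{Q}$-functor $f:X\to Y$: $f_*:X\nrightarrow Y$, $f_*(x,y)=1_Y^*(fx,y)$, and $f^*:Y\nrightarrow X$, $f^*(y,x)=1_Y^*(y,fx)$. Let $\{s\}$ be the one-object $\mathcal{Q}$-category of type $s\in\mathcal{Q}_0$ with hom $1_s$. $\mathsf{P}X$ is the $\mathcal{Q}$-category of distributors $\sigma:X\nrightarrow\{s\}$ ($|\sigma|=s$) with $1_{\mathsf{P}X}^*(\sigma,\sigma')=\bigwedge_x\sigma'(x)\swarrow\sigma(x)$; $\mathsf{P}^{\dag}X$ is the $\mathcal{Q}$-category of distributors $\tau:\{s\}\nrightarrow X$ ($|\tau|=s$) with $1_{\mathsf{P}^{\dag}X}^*(\tau,\tau')=\bigwedge_x\tau'(x)\searrow\tau(x)$ (so $\tau\leq\tau'$ in $\mathsf{P}^{\dag}X$ iff $\tau'\preceq\tau$). Yoneda embeddings: $\mathsf{y}_X:X\to\mathsf{P}X$, $x\mapsto 1_X^*(-,x)$; $\mathsf{y}^{\dag}_X:X\to\mathsf{P}^{\dag}X$, $x\mapsto 1_X^*(x,-)$. For $f:X\to Y$: $f_!:\mathsf{P}X\to\mathsf{P}Y$, $\sigma\mapsto\sigma\circ f^*$; $f^!:\mathsf{P}Y\to\mathsf{P}X$, $\sigma\mapsto\sigma\circ f_*$; $f_{\text{!`}}:\mathsf{P}^{\dag}X\to\mathsf{P}^{\dag}Y$, $\tau\mapsto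 f_*\circ\tau$; $f^{\text{!`}}:\mathsf{P}^{\dag}Y\to\mathsf{P}^{\dag}X$, $\tau\mapsto f^*\circ\tau$; iterated decorations are applied from left to right, e.g. $f_{\text{!`}\,!}=(f_{\text{!`}})_!$. For a distributor $\phi:X\nrightarrow Y$, $\overleftarrow{\phi}:Y\to\mathsf{P}X$ is $y\mapsto\phi(-,y)$. The presheaf 2-monad $\mathbb{P}=(\mathsf{P},\mathsf{s},\mathsf{y})$ sends $f$ to $f_!$, with unit $\mathsf{y}$ and multiplication $\mathsf{s}_X=\mathsf{y}_X^!:\mathsf{P}\mathsf{P}X\to\mathsf{P}X$. The double presheaf 2-monad $\mathbb{P}\mathbb{P}^{\dag}$ has underlying 2-functor $X\mapsto\mathsf{P}\mathsf{P}^{\dag}X$, $f\mapsto f_{\text{!`}\,!}$, unit $\mathfrak{y}_X=\mathsf{y}_{\mathsf{P}^{\dag}X}\cdot\mathsf{y}^{\dag}_X:X\to\mathsf{P}\mathsf{P}^{\dag}X$ and multiplication $\mathfrak{s}_X=((\mathsf{y}_{\mathsf{P}^{\dag}X})_{\text{!`}}\cdot\mathsf{y}^{\dag}_{\mathsf{P}^{\dag}X})^!:\mathsf{P}\mathsf{P}^{\dag}\mathsf{P}\mathsf{P}^{\dag}X\to\mathsf{P}\mathsf{P}^{\dag}X$. Distributive laws ("distributive law" means lax distributive law). For a 2-monad $\mathbb{T}=(T,m,e)$ on $\mathcal{Q}\text{-}\mathbf{Cat}$, a distributive law $\lambda:T\mathsf{P}\to\mathsf{P}T$ of $\mathbb{T}$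 over $\mathbb{P}$ is a family of $\mathcal{Q}$-functors $\lambda_X:T\mathsf{P}X\to\mathsf{P}TX$ such that for all $\mathcal{Q}$-functors $f:X\to Y$: (a) $(Tf)_!\cdot\lambda_X\leq\lambda_Y\cdot T(f_!)$; (b) $\mathsf{y}_{TX}\leq\lambda_X\cdot T\mathsf{y}_X$; (c) $\mathsf{s}_{TX}\cdot(\lambda_X)_!\cdot\lambda_{\mathsf{P}X}\leq\lambda_X\cdot T\mathsf{s}_X$; (d) $(e_X)_!\leq\lambda_X\cdot e_{\mathsf{P}X}$; (e) $(m_X)_!\cdot\lambda_{TX}\cdot T\lambda_X\leq\lambda_X\cdot m_{\mathsf{P}X}$. It is flat if (b) is an equality for all $X$. "$\mathbb{T}$ distributes flatly over $\mathbb{P}$ by $\lambda$" means that $\lambda$ is a flat distributive law. *)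

theory Defs
  imports "HOL-Algebra.Complete_Lattice"
begin

section \<open>Quantaloids\<close>

record ('o, 'm) quantaloid =
  Obj :: "'o set"
  Arr :: "'m set"
  Dom :: "'m \<Rightarrow> 'o"
  Cod :: "'m \<Rightarrow> 'o"
  Comp :: "'m \<Rightarrow> 'm \<Rightarrow> 'm"  (infixl \<open>\<cdot>\<index>\<close> 70)
  Ident :: "'o \<Rightarrow> 'm"
  Le :: "'m \<Rightarrow> 'm \<Rightarrow> bool"  (infix \<open>\<preceq>\<index>\<close> 50)

definition Hom :: "('o, 'm) quantaloid \<Rightarrow> 'o \<Rightarrow> 'o \<Rightarrow> 'm gorder" where
  "Hom Q r s = \<lparr>carrier = {u \<in> Arr Q. Dom Q u = r \<and> Cod Q u = s}, eq = (=), le = Le Q\<rparr>"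

abbreviation hom_set :: "('o, 'm) quantaloid \<Rightarrow> 'o \<Rightarrow> 'o \<Rightarrow> 'm set" where
  "hom_set Q r s \<equiv> carrier (Hom Q r s)"

text \<open>\<open>Comp Q v u\<close> is the composite \<open>v \<circ> u\<close> of \<open>u : r \<rightarrow> s\<close> and \<open>v : s \<rightarrow> t\<close>.  The suprema include
  those of empty families, so composition preserves bottom elements.\<close>

locale quantaloid =
  fixes Q :: "('o, 'm) quantaloid" (structure)
  assumes Dom_Obj: "u \<in> Arr Q \<Longrightarrow> Dom Q u \<in> Obj Q"
    and Cod_Obj: "u \<in> Arr Q \<Longrightarrow> Cod Q u \<in> Obj Q"
    and Ident_hom: "s \<in> Obj Q \<Longrightarrow> Ident Q s \<in> hom_set Q s s"
    and Comp_hom: "\<lbrakk>u \<in> hom_set Q r s; v \<in> hom_set Q s t\<rbrakk> \<Longrightarrow> v \<cdot> u \<in> hom_set Q r t"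
    and Comp_assoc:
      "\<lbrakk>u \<in> hom_set Q r s; v \<in> hom_set Q s t; w \<in> hom_set Q t q\<rbrakk> \<Longrightarrow> w \<cdot> (v \<cdot> u) = (w \<cdot> v) \<cdot> u"
    and Comp_Ident: "u \<in> hom_set Q r s \<Longrightarrow> u \<cdot> Ident Q r = u"
    and Ident_Comp: "u \<in> hom_set Q r s \<Longrightarrow> Ident Q s \<cdot> u = u"
    and Hom_complete_lattice: "\<lbrakk>r \<in> Obj Q; s \<in> Obj Q\<rbrakk> \<Longrightarrow> complete_lattice (Hom Q r s)"
    and Sup_Comp:
      "\<lbrakk>r \<in> Obj Q; s \<in> Obj Q; t \<in> Obj Q; u \<in> hom_set Q r s; A \<subseteq> hom_set Q s t\<rbrakk>
        \<Longrightarrow> (\<Squnion>\<^bsub>Hom Q s t\<^esub> A) \<cdot> u = \<Squnion>\<^bsub>Hom Q r t\<^esub> ((\<lambda>v. v \<cdot> u) ` A)"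
    and Comp_Sup:
      "\<lbrakk>r \<in> Obj Q; s \<in> Obj Q; t \<in> Obj Q; v \<in> hom_set Q s t; A \<subseteq> hom_set Q r s\<rbrakk>
        \<Longrightarrow> v \<cdot> (\<Squnion>\<^bsub>Hom Q r s\<^esub> A) = \<Squnion>\<^bsub>Hom Q r t\<^esub> ((\<lambda>u. v \<cdot> u) ` A)"

text \<open>The descriptions denote when \<open>v\<close>, \<open>w\<close> have a common codomain, respectively \<open>u\<close>, \<open>w\<close> a common
  domain: existence and uniqueness then follow from \<open>Comp_Sup\<close>, \<open>Sup_Comp\<close> and the completeness of
  the hom-sets.\<close>

definition rres :: "('o, 'm) quantaloid \<Rightarrow> 'm \<Rightarrow> 'm \<Rightarrow> 'm"  (infix \<open>\<searrow>\<index>\<close> 65) where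
  "v \<searrow>\<^bsub>Q\<^esub> w = (THE z. z \<in> hom_set Q (Dom Q w) (Dom Q v) \<and>
     (\<forall>u \<in> hom_set Q (Dom Q w) (Dom Q v). u \<preceq>\<^bsub>Q\<^esub> z \<longleftrightarrow> v \<cdot>\<^bsub>Q\<^esub> u \<preceq>\<^bsub>Q\<^esub> w))"

definition lres :: "('o, 'm) quantaloid \<Rightarrow> 'm \<Rightarrow> 'm \<Rightarrow> 'm"  (infix \<open>\<swarrow>\<index>\<close> 65) where
  "w \<swarrow>\<^bsub>Q\<^esub> u = (THE z. z \<in> hom_set Q (Cod Q u) (Cod Q w) \<and>
     (\<forall>v \<in> hom_set Q (Cod Q u) (Cod Q w). v \<preceq>\<^bsub>Q\<^esub> z \<longleftrightarrow> v \<cdot>\<^bsub>Q\<^esub> u \<preceq>\<^bsub>Q\<^esub> w))"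


section \<open>Relations, categories, functors and distributors over a quantaloid\<close>

record ('a, 'o) typed_set = "'a partial_object" +
  tp :: "'a \<Rightarrow> 'o"

record ('a, 'o, 'm) qcat = "('a, 'o) typed_set" +
  hm :: "'a \<Rightarrow> 'a \<Rightarrow> 'm"

text \<open>Relations are extensional (undefined off the carriers), so that equal relations are equal
  HOL functions.  This matters because distributors become elements of presheaf categories.\<close>

definition qrel :: "('o, 'm) quantaloid \<Rightarrow> ('a, 'o, 'x) typed_set_scheme \<Rightarrow>
    ('b, 'o, 'y) typed_set_scheme \<Rightarrow> ('a \<Rightarrow> 'b \<Rightarrow> 'm) set" where
  "qrel Q X Y = (\<Pi>\<^sub>E x \<in> carrier X. \<Pi>\<^sub>E y \<in> carrier Y. hom_set Q (tp X x) (tp Y y))"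

definition qrel_le :: "('o, 'm) quantaloid \<Rightarrow> ('a, 'o, 'x) typed_set_scheme \<Rightarrow>
    ('b, 'o, 'y) typed_set_scheme \<Rightarrow> ('a \<Rightarrow> 'b \<Rightarrow> 'm) \<Rightarrow> ('a \<Rightarrow> 'b \<Rightarrow> 'm) \<Rightarrow> bool" where
  "qrel_le Q X Y \<phi> \<psi> \<longleftrightarrow> (\<forall>x \<in> carrier X. \<forall>y \<in> carrier Y. \<phi> x y \<preceq>\<^bsub>Q\<^esub> \<psi> x y)"

definition qrel_comp :: "('o, 'm) quantaloid \<Rightarrow> ('a, 'o, 'x) typed_set_scheme \<Rightarrow>
    ('b, 'o, 'y) typed_set_scheme \<Rightarrow> ('c, 'o, 'z) typed_set_scheme \<Rightarrow>
    ('b \<Rightarrow> 'c \<Rightarrow> 'm) \<Rightarrow> ('a \<Rightarrow> 'b \<Rightarrow> 'm) \<Rightarrow> 'a \<Rightarrow> 'c \<Rightarrow> 'm" where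
  "qrel_comp Q X Y Z \<psi> \<phi> = (\<lambda>x \<in> carrier X. \<lambda>z \<in> carrier Z.
     \<Squnion>\<^bsub>Hom Q (tp X x) (tp Z z)\<^esub> ((\<lambda>y. \<psi> y z \<cdot>\<^bsub>Q\<^esub> \<phi> x y) ` carrier Y))"

definition is_qcat :: "('o, 'm) quantaloid \<Rightarrow> ('a, 'o, 'm) qcat \<Rightarrow> bool" where
  "is_qcat Q X \<longleftrightarrow> tp X \<in> carrier X \<rightarrow> Obj Q \<and> hm X \<in> qrel Q X X \<and>
     (\<forall>x \<in> carrier X. Ident Q (tp X x) \<preceq>\<^bsub>Q\<^esub> hm X x x) \<and>
     qrel_le Q X X (qrel_comp Q X X X (hm X) (hm X)) (hm X)"

definition qcat_le :: "('o, 'm) quantaloid \<Rightarrow> ('a, 'o, 'm) qcat \<Rightarrow> 'a \<Rightarrow> 'a \<Rightarrow> bool" where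
  "qcat_le Q X x x' \<longleftrightarrow> x \<in> carrier X \<and> x' \<in> carrier X \<and> tp X x = tp X x' \<and>
     Ident Q (tp X x) \<preceq>\<^bsub>Q\<^esub> hm X x x'"

text \<open>Functors are HOL functions of which only the values on the carrier matter; accordingly they are
  compared by \<open>qfun_eq\<close> and \<open>qfun_le\<close>, both quantified over the carrier.\<close>

definition qfunctor :: "('o, 'm) quantaloid \<Rightarrow> ('a, 'o, 'm) qcat \<Rightarrow> ('b, 'o, 'm) qcat \<Rightarrow>
    ('a \<Rightarrow> 'b) \<Rightarrow> bool" where
  "qfunctor Q X Y f \<longleftrightarrow> is_qcat Q X \<and> is_qcat Q Y \<and> f \<in> carrier X \<rightarrow> carrier Y \<and>
     (\<forall>x \<in> carrier X. tp Y (f x) = tp X x) \<and>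
     (\<forall>x \<in> carrier X. \<forall>x' \<in> carrier X. hm X x x' \<preceq>\<^bsub>Q\<^esub> hm Y (f x) (f x'))"

definition qfun_le :: "('o, 'm) quantaloid \<Rightarrow> ('a, 'o, 'm) qcat \<Rightarrow> ('b, 'o, 'm) qcat \<Rightarrow>
    ('a \<Rightarrow> 'b) \<Rightarrow> ('a \<Rightarrow> 'b) \<Rightarrow> bool" where
  "qfun_le Q X Y f g \<longleftrightarrow> (\<forall>x \<in> carrier X. qcat_le Q Y (f x) (g x))"

definition qfun_eq :: "('a, 'o, 'm) qcat \<Rightarrow> ('a \<Rightarrow> 'b) \<Rightarrow> ('a \<Rightarrow> 'b) \<Rightarrow> bool" where
  "qfun_eq X f g \<longleftrightarrow> (\<forall>x \<in> carrier X. f x = g x)"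

definition distributors :: "('o, 'm) quantaloid \<Rightarrow> ('a, 'o, 'm) qcat \<Rightarrow> ('b, 'o, 'm) qcat \<Rightarrow>
    ('a \<Rightarrow> 'b \<Rightarrow> 'm) set" where
  "distributors Q X Y = {\<phi> \<in> qrel Q X Y.
     qrel_le Q X Y (qrel_comp Q X Y Y (hm Y) (qrel_comp Q X X Y \<phi> (hm X))) \<phi>}"

text \<open>\<open>graph X Y f\<close> is \<open>f\<^sub>* : X \<nrightarrow> Y\<close> and \<open>cograph X Y f\<close> is \<open>f\<^sup>* : Y \<nrightarrow> X\<close>.\<close>

definition graph :: "('a, 'o, 'm) qcat \<Rightarrow> ('b, 'o, 'm) qcat \<Rightarrow> ('a \<Rightarrow> 'b) \<Rightarrow> 'a \<Rightarrow> 'b \<Rightarrow> 'm" where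
  "graph X Y f = (\<lambda>x \<in> carrier X. \<lambda>y \<in> carrier Y. hm Y (f x) y)"

definition cograph :: "('a, 'o, 'm) qcat \<Rightarrow> ('b, 'o, 'm) qcat \<Rightarrow> ('a \<Rightarrow> 'b) \<Rightarrow> 'b \<Rightarrow> 'a \<Rightarrow> 'm" where
  "cograph X Y f = (\<lambda>y \<in> carrier Y. \<lambda>x \<in> carrier X. hm Y y (f x))"


section \<open>Presheaves and copresheaves\<close>

text \<open>The one-object category \<open>{s}\<close> lives on the type \<open>unit\<close>.\<close>

definition one_qcat :: "('o, 'm) quantaloid \<Rightarrow> 'o \<Rightarrow> (unit, 'o, 'm) qcat" where
  "one_qcat Q s = \<lparr>carrier = {()}, tp = (\<lambda>_. s), hm = (\<lambda>_ _. Ident Q s)\<rparr>"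

text \<open>A presheaf \<open>\<sigma> : X \<nrightarrow> {s}\<close> is stored together with \<open>s\<close>, which the function alone does not
  determine when \<open>X\<close> is empty.\<close>

type_synonym ('a, 'o, 'm) psh = "'o \<times> ('a \<Rightarrow> unit \<Rightarrow> 'm)"
type_synonym ('a, 'o, 'm) copsh = "'o \<times> (unit \<Rightarrow> 'a \<Rightarrow> 'm)"

definition PSh :: "('o, 'm) quantaloid \<Rightarrow> ('a, 'o, 'm) qcat \<Rightarrow> (('a, 'o, 'm) psh, 'o, 'm) qcat" where
  "PSh Q X =
    (let C = {(s, \<sigma>). s \<in> Obj Q \<and> \<sigma> \<in> distributors Q X (one_qcat Q s)} in
     \<lparr>carrier = C, tp = fst,
      hm = (\<lambda>p \<in> C. \<lambda>p' \<in> C. \<Sqinter>\<^bsub>Hom Q (fst p) (fst p')\<^esub>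
              ((\<lambda>x. snd p' x () \<swarrow>\<^bsub>Q\<^esub> snd p x ()) ` carrier X))\<rparr>)"

definition CoPSh :: "('o, 'm) quantaloid \<Rightarrow> ('a, 'o, 'm) qcat \<Rightarrow> (('a, 'o, 'm) copsh, 'o, 'm) qcat" where
  "CoPSh Q X =
    (let C = {(s, \<tau>). s \<in> Obj Q \<and> \<tau> \<in> distributors Q (one_qcat Q s) X} in
     \<lparr>carrier = C, tp = fst,
      hm = (\<lambda>p \<in> C. \<lambda>p' \<in> C. \<Sqinter>\<^bsub>Hom Q (fst p) (fst p')\<^esub>
              ((\<lambda>x. snd p' () x \<searrow>\<^bsub>Q\<^esub> snd p () x) ` carrier X))\<rparr>)"

text \<open>\<open>lvec X Y \<phi>\<close> is \<open>y \<mapsto> \<phi>(-, y) : Y \<rightarrow> PX\<close> for a distributor \<open>\<phi> : X \<nrightarrow> Y\<close>.\<close>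

definition lvec :: "('a, 'o, 'm) qcat \<Rightarrow> ('b, 'o, 'm) qcat \<Rightarrow> ('a \<Rightarrow> 'b \<Rightarrow> 'm) \<Rightarrow>
    'b \<Rightarrow> ('a, 'o, 'm) psh" where
  "lvec X Y \<phi> y = (tp Y y, \<lambda>x \<in> carrier X. \<lambda>_. \<phi> x y)"

definition yoneda :: "('a, 'o, 'm) qcat \<Rightarrow> 'a \<Rightarrow> ('a, 'o, 'm) psh" where
  "yoneda X x = (tp X x, \<lambda>x' \<in> carrier X. \<lambda>_. hm X x' x)"

definition coyoneda :: "('a, 'o, 'm) qcat \<Rightarrow> 'a \<Rightarrow> ('a, 'o, 'm) copsh" where
  "coyoneda X x = (tp X x, \<lambda>_. \<lambda>x' \<in> carrier X. hm X x x')"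

text \<open>For \<open>f : X \<rightarrow> Y\<close>: \<open>psh_push\<close> is \<open>f\<^sub>!\<close>, \<open>psh_pull\<close> is \<open>f\<^sup>!\<close>, and \<open>copsh_push\<close> is the covariant
  action on copresheaves (inverted exclamation mark as subscript).\<close>

definition psh_push :: "('o, 'm) quantaloid \<Rightarrow> ('a, 'o, 'm) qcat \<Rightarrow> ('b, 'o, 'm) qcat \<Rightarrow>
    ('a \<Rightarrow> 'b) \<Rightarrow> ('a, 'o, 'm) psh \<Rightarrow> ('b, 'o, 'm) psh" where
  "psh_push Q X Y f = (\<lambda>(s, \<sigma>). (s, qrel_comp Q Y X (one_qcat Q s) \<sigma> (cograph X Y f)))"

definition psh_pull :: "('o, 'm) quantaloid \<Rightarrow> ('a, 'o, 'm) qcat \<Rightarrow> ('b, 'o, 'm) qcat \<Rightarrow>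
    ('a \<Rightarrow> 'b) \<Rightarrow> ('b, 'o, 'm) psh \<Rightarrow> ('a, 'o, 'm) psh" where
  "psh_pull Q X Y f = (\<lambda>(s, \<sigma>). (s, qrel_comp Q X Y (one_qcat Q s) \<sigma> (graph X Y f)))"

definition copsh_push :: "('o, 'm) quantaloid \<Rightarrow> ('a, 'o, 'm) qcat \<Rightarrow> ('b, 'o, 'm) qcat \<Rightarrow>
    ('a \<Rightarrow> 'b) \<Rightarrow> ('a, 'o, 'm) copsh \<Rightarrow> ('b, 'o, 'm) copsh" where
  "copsh_push Q X Y f = (\<lambda>(s, \<tau>). (s, qrel_comp Q (one_qcat Q s) X Y (graph X Y f) \<tau>))"

definition psh_mult :: "('o, 'm) quantaloid \<Rightarrow> ('a, 'o, 'm) qcat \<Rightarrow>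
    (('a, 'o, 'm) psh, 'o, 'm) psh \<Rightarrow> ('a, 'o, 'm) psh" where
  "psh_mult Q X = psh_pull Q X (PSh Q X) (yoneda X)"


section \<open>The double presheaf 2-monad\<close>

type_synonym ('a, 'o, 'm) dpsh = "(('a, 'o, 'm) copsh, 'o, 'm) psh"

definition DPSh :: "('o, 'm) quantaloid \<Rightarrow> ('a, 'o, 'm) qcat \<Rightarrow> (('a, 'o, 'm) dpsh, 'o, 'm) qcat" where
  "DPSh Q X = PSh Q (CoPSh Q X)"

definition dpsh_map :: "('o, 'm) quantaloid \<Rightarrow> ('a, 'o, 'm) qcat \<Rightarrow> ('b, 'o, 'm) qcat \<Rightarrow>
    ('a \<Rightarrow> 'b) \<Rightarrow> ('a, 'o, 'm) dpsh \<Rightarrow> ('b, 'o, 'm) dpsh" where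
  "dpsh_map Q X Y f = psh_push Q (CoPSh Q X) (CoPSh Q Y) (copsh_push Q X Y f)"

definition dpsh_unit :: "('o, 'm) quantaloid \<Rightarrow> ('a, 'o, 'm) qcat \<Rightarrow> 'a \<Rightarrow> ('a, 'o, 'm) dpsh" where
  "dpsh_unit Q X = yoneda (CoPSh Q X) \<circ> coyoneda X"

definition dpsh_mult :: "('o, 'm) quantaloid \<Rightarrow> ('a, 'o, 'm) qcat \<Rightarrow>
    (('a, 'o, 'm) dpsh, 'o, 'm) dpsh \<Rightarrow> ('a, 'o, 'm) dpsh" where
  "dpsh_mult Q X = psh_pull Q (CoPSh Q X) (CoPSh Q (DPSh Q X))
     (copsh_push Q (CoPSh Q X) (DPSh Q X) (yoneda (CoPSh Q X)) \<circ> coyoneda (CoPSh Q X))"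

definition Lam :: "('o, 'm) quantaloid \<Rightarrow> ('a, 'o, 'm) qcat \<Rightarrow>
    (('a, 'o, 'm) psh, 'o, 'm) dpsh \<Rightarrow> (('a, 'o, 'm) dpsh, 'o, 'm) psh" where
  "Lam Q X = lvec (DPSh Q X) (DPSh Q (PSh Q X))
     (graph (DPSh Q X) (DPSh Q (PSh Q X)) (dpsh_map Q X (PSh Q X) (yoneda X)))"

end

theory Submission
  imports Defs
begin

text \<open>Write \<open>D = PP\<^sup>\<dagger>\<close> for the double presheaf 2-functor.  The idea is that
  \<open>\<Lambda>\<close> takes representable values.  The functor \<open>D y\<^sub>X : D X \<rightarrow> D P X\<close> is a direct image of
  presheaves, so it has the inverse image \<open>R\<^sub>X\<close> as a right adjoint, and this adjunction turns the
  presheaf \<open>\<Lambda>\<^sub>X(\<xi>) = 1\<^sup>*(D y\<^sub>X(-), \<xi>)\<close> into the representable presheaf at \<open>R\<^sub>X(\<xi>)\<close>: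
  \<open>\<Lambda>\<^sub>X = y\<^sub>D\<^sub>X \<cdot> R\<^sub>X\<close> (\<open>Lam_eq\<close>).  Since direct images preserve representables
  (\<open>psh_push_yoneda\<close>) and the multiplication of the presheaf monad evaluates them
  (\<open>psh_mult_yoneda\<close>), each axiom except the one for the unit \<open>e\<close> of \<open>D\<close> loses its outer
  presheaf layer.  What remains is an inequality between functors into a double presheaf category, to be settled by
  the adjunction of \<open>D y\<^sub>X\<close> and \<open>R\<^sub>X\<close>.

  Flatness is \<open>R\<^sub>X \<cdot> D y\<^sub>X = 1\<close>, which holds because \<open>y\<^sub>X\<close>, and with it the direct image of
  copresheaves along it, is fully faithful.  Lax naturality is \<open>D f \<cdot> R\<^sub>X \<le> R\<^sub>Y \<cdot> D f\<^sub>!\<close>, the mate of the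
  naturality square of \<open>y\<close>.  Compatibility with the multiplication of the presheaf monad follows
  from \<open>R\<^sub>P\<^sub>X = D s\<^sub>X \<cdot> D y\<^sub>P\<^sub>X \<cdot> R\<^sub>P\<^sub>X \<le> D s\<^sub>X\<close>.  For the multiplication \<open>m\<close> of \<open>D\<close>, flatness
  collapses the two nested copies of \<open>\<Lambda>\<close> to \<open>D R\<^sub>X\<close>, and one needs
  \<open>m\<^sub>X \<cdot> D R\<^sub>X \<le> R\<^sub>X \<cdot> m\<^sub>P\<^sub>X\<close>; its transpose is \<open>D y\<^sub>X \<cdot> m\<^sub>X \<cdot> D R\<^sub>X \<le> m\<^sub>P\<^sub>X \<cdot> D(D y\<^sub>X \<cdot> R\<^sub>X) \<le> m\<^sub>P\<^sub>X\<close>.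
  The axiom for \<open>e\<close> transposes to the statement that \<open>e\<^sub>P\<^sub>X\<close> does not decrease the hom
  \<open>\<sigma>(x) = 1\<^sup>*(y\<^sub>X x, \<sigma>)\<close>.

  All the ingredients (functoriality, monotonicity and naturality of direct images) are derived
  from two enriched Galois connections, \<open>psh_push_adjoint_pull\<close> and \<open>copsh_pull_adjoint_push\<close>,
  together with the antisymmetry of the presheaf orders, so that equalities can be proved by
  comparing lower or upper bounds.\<close>

section \<open>Order and residuation in a quantaloid\<close>

context quantaloid
begin

lemma hom_iff: "u \<in> hom_set Q r s \<longleftrightarrow> u \<in> Arr Q \<and> Dom Q u = r \<and> Cod Q u = s"
  by (simp add: Hom_def)

lemma hom_Obj: "u \<in> hom_set Q r s \<Longrightarrow> r \<in> Obj Q \<and> s \<in> Obj Q"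
  using Dom_Obj Cod_Obj by (auto simp: hom_iff)

lemma le_Hom [simp]: "le (Hom Q r s) = Le Q"
  by (simp add: Hom_def)

lemma eq_Hom [simp]: "eq (Hom Q r s) = (=)"
  by (simp add: Hom_def)

lemma le_refl: "u \<in> hom_set Q r s \<Longrightarrow> u \<preceq> u"
proof -
  assume u: "u \<in> hom_set Q r s"
  then interpret complete_lattice "Hom Q r s" using Hom_complete_lattice hom_Obj by blast
  show ?thesis using le_refl u by simp
qed

lemma le_antisym:
  assumes "u \<preceq> v" "v \<preceq> u" and u: "u \<in> hom_set Q r s" and v: "v \<in> hom_set Q r s"
  shows "u = v"
proof -
  interpret complete_lattice "Hom Q r s" using Hom_complete_lattice hom_Obj u by blast
  show ?thesis using le_antisym[of u v] assms by simp
qed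

lemma le_trans:
  assumes "u \<preceq> v" "v \<preceq> w" and u: "u \<in> hom_set Q r s" and v: "v \<in> hom_set Q r s"
    and w: "w \<in> hom_set Q r s"
  shows "u \<preceq> w"
proof -
  interpret complete_lattice "Hom Q r s" using Hom_complete_lattice hom_Obj u by blast
  show ?thesis using le_trans[of u v w] assms by simp
qed

lemma Sup_hom:
  assumes "r \<in> Obj Q" "s \<in> Obj Q" "A \<subseteq> hom_set Q r s"
  shows "\<Squnion>\<^bsub>Hom Q r s\<^esub> A \<in> hom_set Q r s"
proof -
  interpret complete_lattice "Hom Q r s" using Hom_complete_lattice assms by blast
  show ?thesis using sup_closed assms by simp
qed

lemma Sup_upper:
  assumes "r \<in> Obj Q" "s \<in> Obj Q" "A \<subseteq> hom_set Q r s" "u \<in> A"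
  shows "u \<preceq> \<Squnion>\<^bsub>Hom Q r s\<^esub> A"
proof -
  interpret complete_lattice "Hom Q r s" using Hom_complete_lattice assms by blast
  show ?thesis using sup_upper[of A u] assms by simp
qed

lemma Sup_le_iff:
  assumes "r \<in> Obj Q" "s \<in> Obj Q" "A \<subseteq> hom_set Q r s" "v \<in> hom_set Q r s"
  shows "\<Squnion>\<^bsub>Hom Q r s\<^esub> A \<preceq> v \<longleftrightarrow> (\<forall>u\<in>A. u \<preceq> v)"
proof
  show "\<forall>u\<in>A. u \<preceq> v" if "\<Squnion>\<^bsub>Hom Q r s\<^esub> A \<preceq> v"
    using le_trans[OF Sup_upper that] Sup_hom assms by blast
  interpret complete_lattice "Hom Q r s" using Hom_complete_lattice assms by blast
  show "\<Squnion>\<^bsub>Hom Q r s\<^esub> A \<preceq> v" if "\<forall>u\<in>A. u \<preceq> v"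
    using sup_least[of A v] assms that by (simp add: Upper_def subset_iff)
qed

lemma Inf_hom:
  assumes "r \<in> Obj Q" "s \<in> Obj Q" "A \<subseteq> hom_set Q r s"
  shows "\<Sqinter>\<^bsub>Hom Q r s\<^esub> A \<in> hom_set Q r s"
proof -
  interpret complete_lattice "Hom Q r s" using Hom_complete_lattice assms by blast
  show ?thesis using inf_closed assms by simp
qed

lemma Inf_lower:
  assumes "r \<in> Obj Q" "s \<in> Obj Q" "A \<subseteq> hom_set Q r s" "u \<in> A"
  shows "\<Sqinter>\<^bsub>Hom Q r s\<^esub> A \<preceq> u"
proof -
  interpret complete_lattice "Hom Q r s" using Hom_complete_lattice assms by blast
  show ?thesis using inf_lower[of A u] assms by simp
qed

lemma le_Inf_iff:
  assumes "r \<in> Obj Q" "s \<in> Obj Q" "A \<subseteq> hom_set Q r s" "v \<in> hom_set Q r s"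
  shows "v \<preceq> \<Sqinter>\<^bsub>Hom Q r s\<^esub> A \<longleftrightarrow> (\<forall>u\<in>A. v \<preceq> u)"
proof
  show "\<forall>u\<in>A. v \<preceq> u" if "v \<preceq> \<Sqinter>\<^bsub>Hom Q r s\<^esub> A"
    using le_trans[OF that Inf_lower] Inf_hom assms by blast
  interpret complete_lattice "Hom Q r s" using Hom_complete_lattice assms by blast
  show "v \<preceq> \<Sqinter>\<^bsub>Hom Q r s\<^esub> A" if "\<forall>u\<in>A. v \<preceq> u"
    using inf_greatest[of A v] assms that by (simp add: Lower_def subset_iff)
qed

lemma Sup_Comp_le_iff:
  assumes u: "u \<in> hom_set Q r s" and A: "A \<subseteq> hom_set Q s t" and w: "w \<in> hom_set Q r t"
  shows "(\<Squnion>\<^bsub>Hom Q s t\<^esub> A) \<cdot> u \<preceq> w \<longleftrightarrow> (\<forall>v\<in>A. v \<cdot> u \<preceq> w)"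
proof -
  note obj = hom_Obj[OF u] hom_Obj[OF w]
  have "(\<lambda>v. v \<cdot> u) ` A \<subseteq> hom_set Q r t"
    using A Comp_hom[OF u] by auto
  then show ?thesis
    using Sup_Comp[of r s t u A] obj u A w by (simp add: Sup_le_iff)
qed

lemma Comp_Sup_le_iff:
  assumes v: "v \<in> hom_set Q s t" and A: "A \<subseteq> hom_set Q r s" and w: "w \<in> hom_set Q r t"
  shows "v \<cdot> (\<Squnion>\<^bsub>Hom Q r s\<^esub> A) \<preceq> w \<longleftrightarrow> (\<forall>u\<in>A. v \<cdot> u \<preceq> w)"
proof -
  note obj = hom_Obj[OF v] hom_Obj[OF w]
  have "(\<lambda>u. v \<cdot> u) ` A \<subseteq> hom_set Q r t"
    using A Comp_hom[OF _ v] by auto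
  then show ?thesis
    using Comp_Sup[of r s t v A] obj v A w by (simp add: Sup_le_iff)
qed

text \<open>A binary supremum is a special case of the suprema that composition preserves, and
  \<open>u \<preceq> u'\<close> says that \<open>u'\<close> is the supremum of \<open>{u, u'}\<close>.\<close>

lemma Comp_mono_left:
  assumes le: "v \<preceq> v'" and u: "u \<in> hom_set Q r s" and v: "v \<in> hom_set Q s t" "v' \<in> hom_set Q s t"
  shows "v \<cdot> u \<preceq> v' \<cdot> u"
proof -
  note obj = hom_Obj[OF u] hom_Obj[OF v(1)]
  have "(\<Squnion>\<^bsub>Hom Q s t\<^esub> {v, v'}) = v'"
    using obj v le le_refl Sup_upper[of s t "{v, v'}" "v'"]
    by (intro le_antisym[of _ _ s t]) (auto simp: Sup_le_iff Sup_hom)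
  then show ?thesis
    using Sup_Comp_le_iff[of u r s "{v,v'}" t "v' \<cdot> u"] u v Comp_hom[OF u v(2)] le_refl by auto
qed

lemma Comp_mono_right:
  assumes le: "u \<preceq> u'" and u: "u \<in> hom_set Q r s" "u' \<in> hom_set Q r s" and v: "v \<in> hom_set Q s t"
  shows "v \<cdot> u \<preceq> v \<cdot> u'"
proof -
  note obj = hom_Obj[OF u(1)] hom_Obj[OF v]
  have "(\<Squnion>\<^bsub>Hom Q r s\<^esub> {u, u'}) = u'"
    using obj u le le_refl Sup_upper[of r s "{u, u'}" "u'"]
    by (intro le_antisym[of _ _ r s]) (auto simp: Sup_le_iff Sup_hom)
  then show ?thesis
    using Comp_Sup_le_iff[of v s t "{u,u'}" r "v \<cdot> u'"] u v Comp_hom[OF u(2) v] le_refl by auto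
qed

text \<open>The supremum of all \<open>v\<close> with \<open>v \<cdot> u \<preceq> w\<close> is again such a \<open>v\<close>, because composition with \<open>u\<close>
  preserves suprema; it is therefore the element that the description denotes.\<close>

lemma
  assumes u: "u \<in> hom_set Q r s" and w: "w \<in> hom_set Q r t"
  shows lres_hom: "w \<swarrow> u \<in> hom_set Q s t"
    and le_lres_iff: "v \<in> hom_set Q s t \<Longrightarrow> v \<preceq> w \<swarrow> u \<longleftrightarrow> v \<cdot> u \<preceq> w"
proof -
  let ?P = "\<lambda>z. z \<in> hom_set Q s t \<and> (\<forall>v\<in>hom_set Q s t. v \<preceq> z \<longleftrightarrow> v \<cdot> u \<preceq> w)"
  let ?A = "{v \<in> hom_set Q s t. v \<cdot> u \<preceq> w}"
  let ?z = "\<Squnion>\<^bsub>Hom Q s t\<^esub> ?A"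
  note obj = hom_Obj[OF u] hom_Obj[OF w]
  have A: "?A \<subseteq> hom_set Q s t" by blast
  have z: "?z \<in> hom_set Q s t" using obj by (simp add: Sup_hom A)
  have zu: "?z \<cdot> u \<preceq> w" using Sup_Comp_le_iff[OF u A w] by blast
  have "v \<preceq> ?z" if "v \<in> hom_set Q s t" "v \<cdot> u \<preceq> w" for v
    using Sup_le_iff[of s t ?A ?z] obj A z le_refl[OF z] that by blast
  moreover have "v \<cdot> u \<preceq> w" if v: "v \<in> hom_set Q s t" "v \<preceq> ?z" for v
    by (rule le_trans[OF Comp_mono_left[OF v(2) u v(1) z] zu])
      (use u v z w Comp_hom in blast)+
  ultimately have P: "?P ?z" using z by blast
  have uniq: "z' = ?z" if "?P z'" for z'
    by (rule le_antisym[of _ _ s t]) (use that P le_refl in blast)+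
  have "w \<swarrow> u = (THE z. ?P z)"
    using u w by (simp add: lres_def hom_iff)
  also have "\<dots> = ?z" by (rule the_equality[of ?P, OF P uniq])
  finally have "?P (w \<swarrow> u)" using P by simp
  then show "w \<swarrow> u \<in> hom_set Q s t"
    and "v \<in> hom_set Q s t \<Longrightarrow> v \<preceq> w \<swarrow> u \<longleftrightarrow> v \<cdot> u \<preceq> w"
    by blast+
qed

lemma
  assumes v: "v \<in> hom_set Q s t" and w: "w \<in> hom_set Q r t"
  shows rres_hom: "v \<searrow> w \<in> hom_set Q r s"
    and le_rres_iff: "u \<in> hom_set Q r s \<Longrightarrow> u \<preceq> v \<searrow> w \<longleftrightarrow> v \<cdot> u \<preceq> w"
proof -
  let ?P = "\<lambda>z. z \<in> hom_set Q r s \<and> (\<forall>u\<in>hom_set Q r s. u \<preceq> z \<longleftrightarrow> v \<cdot> u \<preceq> w)"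
  let ?A = "{u \<in> hom_set Q r s. v \<cdot> u \<preceq> w}"
  let ?z = "\<Squnion>\<^bsub>Hom Q r s\<^esub> ?A"
  note obj = hom_Obj[OF v] hom_Obj[OF w]
  have A: "?A \<subseteq> hom_set Q r s" by blast
  have z: "?z \<in> hom_set Q r s" using obj by (simp add: Sup_hom A)
  have vz: "v \<cdot> ?z \<preceq> w" using Comp_Sup_le_iff[OF v A w] by blast
  have "u \<preceq> ?z" if "u \<in> hom_set Q r s" "v \<cdot> u \<preceq> w" for u
    using Sup_le_iff[of r s ?A ?z] obj A z le_refl[OF z] that by blast
  moreover have "v \<cdot> u \<preceq> w" if u: "u \<in> hom_set Q r s" "u \<preceq> ?z" for u
    by (rule le_trans[OF Comp_mono_right[OF u(2) u(1) z v] vz])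
      (use u v z w Comp_hom in blast)+
  ultimately have P: "?P ?z" using z by blast
  have uniq: "z' = ?z" if "?P z'" for z'
    by (rule le_antisym[of _ _ r s]) (use that P le_refl in blast)+
  have "v \<searrow> w = (THE z. ?P z)"
    using v w by (simp add: rres_def hom_iff)
  also have "\<dots> = ?z" by (rule the_equality[of ?P, OF P uniq])
  finally have "?P (v \<searrow> w)" using P by simp
  then show "v \<searrow> w \<in> hom_set Q r s"
    and "u \<in> hom_set Q r s \<Longrightarrow> u \<preceq> v \<searrow> w \<longleftrightarrow> v \<cdot> u \<preceq> w"
    by blast+
qed

text \<open>The order-theoretic Yoneda principle, by which homs of presheaf categories are compared below.\<close>

lemma hom_eqI_below:
  assumes "u \<in> hom_set Q r s" "v \<in> hom_set Q r s"
    and "\<And>w. w \<in> hom_set Q r s \<Longrightarrow> w \<preceq> u \<longleftrightarrow> w \<preceq> v"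
  shows "u = v"
  using assms le_antisym le_refl by blast

end

section \<open>Categories, presheaves and copresheaves pointwise\<close>

abbreviation psh_at :: "('a, 'o, 'm) psh \<Rightarrow> 'a \<Rightarrow> 'm"  (infixl \<open>\<bullet>\<close> 90) where
  "p \<bullet> x \<equiv> snd p x ()"

abbreviation copsh_at :: "('a, 'o, 'm) copsh \<Rightarrow> 'a \<Rightarrow> 'm"  (infixl \<open>\<star>\<close> 90) where
  "p \<star> x \<equiv> snd p () x"

context quantaloid
begin

lemma qcat_tp: "is_qcat Q X \<Longrightarrow> x \<in> carrier X \<Longrightarrow> tp X x \<in> Obj Q"
  by (auto simp: is_qcat_def)

lemma qcat_hm:
  "is_qcat Q X \<Longrightarrow> x \<in> carrier X \<Longrightarrow> x' \<in> carrier X \<Longrightarrow> hm X x x' \<in> hom_set Q (tp X x) (tp X x')"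
  by (auto simp: is_qcat_def qrel_def dest: PiE_mem)

lemma qcat_Ident: "is_qcat Q X \<Longrightarrow> x \<in> carrier X \<Longrightarrow> Ident Q (tp X x) \<preceq> hm X x x"
  by (auto simp: is_qcat_def)

lemma Sup_singleton:
  assumes u: "u \<in> hom_set Q r s"
  shows "\<Squnion>\<^bsub>Hom Q r s\<^esub> {u} = u"
proof (rule le_antisym[of _ _ r s])
  note ob = hom_Obj[OF u]
  show "\<Squnion>\<^bsub>Hom Q r s\<^esub> {u} \<preceq> u" using Sup_le_iff[of r s "{u}" u] ob u le_refl by simp
  show "u \<preceq> \<Squnion>\<^bsub>Hom Q r s\<^esub> {u}" using Sup_upper[of r s "{u}" u] ob u by simp
  show "\<Squnion>\<^bsub>Hom Q r s\<^esub> {u} \<in> hom_set Q r s" using Sup_hom[of r s "{u}"] ob u by simp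
qed (rule u)

lemma qcat_Ident_hom:
  "is_qcat Q X \<Longrightarrow> x \<in> carrier X \<Longrightarrow> Ident Q (tp X x) \<in> hom_set Q (tp X x) (tp X x)"
  by (rule Ident_hom[OF qcat_tp])

lemma qrel_comp_le_iff:
  assumes "x \<in> carrier X" "z \<in> carrier Z" "w \<in> hom_set Q (tp X x) (tp Z z)"
    and "\<And>y. y \<in> carrier Y \<Longrightarrow> \<psi> y z \<cdot> \<phi> x y \<in> hom_set Q (tp X x) (tp Z z)"
  shows "qrel_comp Q X Y Z \<psi> \<phi> x z \<preceq> w \<longleftrightarrow> (\<forall>y\<in>carrier Y. \<psi> y z \<cdot> \<phi> x y \<preceq> w)"
  using assms hom_Obj[OF assms(3)] by (simp add: qrel_comp_def Sup_le_iff image_subset_iff)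

lemma qrel_comp_hom:
  assumes "x \<in> carrier X" "z \<in> carrier Z" "tp X x \<in> Obj Q" "tp Z z \<in> Obj Q"
    and "\<And>y. y \<in> carrier Y \<Longrightarrow> \<psi> y z \<cdot> \<phi> x y \<in> hom_set Q (tp X x) (tp Z z)"
  shows "qrel_comp Q X Y Z \<psi> \<phi> x z \<in> hom_set Q (tp X x) (tp Z z)"
  using assms by (simp add: qrel_comp_def Sup_hom image_subset_iff)

lemma qcat_hm_comp_hom:
  assumes X: "is_qcat Q X" and x: "x \<in> carrier X" "y \<in> carrier X" "z \<in> carrier X"
  shows "hm X y z \<cdot> hm X x y \<in> hom_set Q (tp X x) (tp X z)"
  by (rule Comp_hom[OF qcat_hm[OF X x(1,2)] qcat_hm[OF X x(2,3)]])

lemma qcat_comp: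
  assumes X: "is_qcat Q X" and x: "x \<in> carrier X" "y \<in> carrier X" "z \<in> carrier X"
  shows "hm X y z \<cdot> hm X x y \<preceq> hm X x z"
proof -
  have "qrel_comp Q X X X (hm X) (hm X) x z \<preceq> hm X x z"
    using X x by (auto simp: is_qcat_def qrel_le_def)
  then show ?thesis
    using qrel_comp_le_iff[OF x(1,3) qcat_hm[OF X x(1,3)], where \<psi> = "hm X" and \<phi> = "hm X"]
      qcat_hm_comp_hom[OF X x(1) _ x(3)] x(2) by blast
qed

lemma is_qcatI:
  assumes "tp X \<in> carrier X \<rightarrow> Obj Q" and hm: "hm X \<in> qrel Q X X"
    and "\<And>x. x \<in> carrier X \<Longrightarrow> Ident Q (tp X x) \<preceq> hm X x x"
    and "\<And>x y z. x \<in> carrier X \<Longrightarrow> y \<in> carrier X \<Longrightarrow> z \<in> carrier X \<Longrightarrow>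
          hm X y z \<cdot> hm X x y \<preceq> hm X x z"
  shows "is_qcat Q X"
proof -
  have hom: "hm X x y \<in> hom_set Q (tp X x) (tp X y)" if "x \<in> carrier X" "y \<in> carrier X" for x y
    using hm that by (auto simp: qrel_def dest: PiE_mem)
  have "qrel_comp Q X X X (hm X) (hm X) x z \<preceq> hm X x z" if "x \<in> carrier X" "z \<in> carrier X" for x z
    using qrel_comp_le_iff[OF that hom[OF that], where \<psi> = "hm X" and \<phi> = "hm X"]
      Comp_hom[OF hom[OF that(1)] hom[OF _ that(2)]] assms(4)[OF that(1) _ that(2)] by blast
  then show ?thesis using assms by (simp add: is_qcat_def qrel_le_def)
qed

lemma qfunctor_carrier: "qfunctor Q X Y f \<Longrightarrow> x \<in> carrier X \<Longrightarrow> f x \<in> carrier Y"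
  and qfunctor_tp: "qfunctor Q X Y f \<Longrightarrow> x \<in> carrier X \<Longrightarrow> tp Y (f x) = tp X x"
  and qfunctor_hm: "qfunctor Q X Y f \<Longrightarrow> x \<in> carrier X \<Longrightarrow> x' \<in> carrier X \<Longrightarrow>
    hm X x x' \<preceq> hm Y (f x) (f x')"
  and qfunctor_dom: "qfunctor Q X Y f \<Longrightarrow> is_qcat Q X"
  and qfunctor_cod: "qfunctor Q X Y f \<Longrightarrow> is_qcat Q Y"
  by (auto simp: qfunctor_def)

lemma
  assumes f: "qfunctor Q X Y f" and x: "x \<in> carrier X"
  shows qfunctor_hom_to: "y \<in> carrier Y \<Longrightarrow> hm Y y (f x) \<in> hom_set Q (tp Y y) (tp X x)"
    and qfunctor_hom_from: "y \<in> carrier Y \<Longrightarrow> hm Y (f x) y \<in> hom_set Q (tp X x) (tp Y y)"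
    and qfunctor_hom: "x' \<in> carrier X \<Longrightarrow> hm Y (f x) (f x') \<in> hom_set Q (tp X x) (tp X x')"
proof -
  note Y = qcat_hm[OF qfunctor_cod[OF f]] and fx = qfunctor_carrier[OF f] and t = qfunctor_tp[OF f]
  show "y \<in> carrier Y \<Longrightarrow> hm Y y (f x) \<in> hom_set Q (tp Y y) (tp X x)"
    using Y[of y "f x"] fx[OF x] t[OF x] by simp
  show "y \<in> carrier Y \<Longrightarrow> hm Y (f x) y \<in> hom_set Q (tp X x) (tp Y y)"
    using Y[of "f x" y] fx[OF x] t[OF x] by simp
  show "x' \<in> carrier X \<Longrightarrow> hm Y (f x) (f x') \<in> hom_set Q (tp X x) (tp X x')"
    using Y[of "f x" "f x'"] fx[OF x] t[OF x] fx[of x'] t[of x'] by simp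
qed

lemma qfunctor_comp:
  assumes f: "qfunctor Q X Y f" and g: "qfunctor Q Y Z g"
  shows "qfunctor Q X Z (g \<circ> f)"
proof -
  have "hm X x x' \<preceq> hm Z (g (f x)) (g (f x'))" if x: "x \<in> carrier X" "x' \<in> carrier X" for x x'
  proof (rule le_trans)
    note fx = qfunctor_carrier[OF f x(1)] qfunctor_carrier[OF f x(2)]
    show "hm X x x' \<preceq> hm Y (f x) (f x')" by (rule qfunctor_hm[OF f x])
    show "hm Y (f x) (f x') \<preceq> hm Z (g (f x)) (g (f x'))" by (rule qfunctor_hm[OF g fx])
    show "hm X x x' \<in> hom_set Q (tp X x) (tp X x')" by (rule qcat_hm[OF qfunctor_dom[OF f] x])
    show "hm Y (f x) (f x') \<in> hom_set Q (tp X x) (tp X x')"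
      by (rule qfunctor_hom[OF f x])
    show "hm Z (g (f x)) (g (f x')) \<in> hom_set Q (tp X x) (tp X x')"
      using qfunctor_hom[OF g fx] by (simp add: qfunctor_tp[OF f] x)
  qed
  then show ?thesis
    using qfunctor_carrier[OF f] qfunctor_tp[OF f] qfunctor_carrier[OF g] qfunctor_tp[OF g]
      qfunctor_dom[OF f] qfunctor_cod[OF g] unfolding qfunctor_def by simp
qed

lemma qcat_le_refl: "is_qcat Q X \<Longrightarrow> x \<in> carrier X \<Longrightarrow> qcat_le Q X x x"
  by (simp add: qcat_le_def qcat_Ident)

lemma qcat_le_carrier: "qcat_le Q X x y \<Longrightarrow> x \<in> carrier X \<and> y \<in> carrier X \<and> tp X x = tp X y"
  by (simp add: qcat_le_def)

lemma qcat_le_hm_mono: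
  assumes X: "is_qcat Q X" and le: "qcat_le Q X x y" and z: "z \<in> carrier X"
  shows "hm X z x \<preceq> hm X z y" and "hm X y z \<preceq> hm X x z"
proof -
  note xy = le[unfolded qcat_le_def]
  have x: "x \<in> carrier X" and y: "y \<in> carrier X" and t: "tp X y = tp X x"
    and id: "Ident Q (tp X x) \<preceq> hm X x y" using xy by auto
  have i: "Ident Q (tp X x) \<in> hom_set Q (tp X x) (tp X x)" by (rule qcat_Ident_hom[OF X x])
  have zx: "hm X z x \<in> hom_set Q (tp X z) (tp X x)" "hm X z y \<in> hom_set Q (tp X z) (tp X x)"
    "hm X x y \<in> hom_set Q (tp X x) (tp X x)"
    "hm X y z \<in> hom_set Q (tp X x) (tp X z)" "hm X x z \<in> hom_set Q (tp X x) (tp X z)"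
    using qcat_hm[OF X z x] qcat_hm[OF X z y] qcat_hm[OF X x y] qcat_hm[OF X y z] qcat_hm[OF X x z] t
    by simp_all
  have "Ident Q (tp X x) \<cdot> hm X z x \<preceq> hm X z y"
    by (rule le_trans[OF Comp_mono_left[OF id zx(1) i zx(3)] qcat_comp[OF X z x y]
        Comp_hom[OF zx(1) i] Comp_hom[OF zx(1) zx(3)] zx(2)])
  then show "hm X z x \<preceq> hm X z y" using Ident_Comp[OF zx(1)] by simp
  have "hm X y z \<cdot> Ident Q (tp X x) \<preceq> hm X x z"
    by (rule le_trans[OF Comp_mono_right[OF id i zx(3) zx(4)] qcat_comp[OF X x y z]
        Comp_hom[OF i zx(4)] Comp_hom[OF zx(3) zx(4)] zx(5)])
  then show "hm X y z \<preceq> hm X x z" using Comp_Ident[OF zx(4)] by simp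
qed

lemma qcat_le_trans:
  assumes X: "is_qcat Q X" and xy: "qcat_le Q X x y" and yz: "qcat_le Q X y z"
  shows "qcat_le Q X x z"
proof -
  note c = qcat_le_carrier[OF xy] qcat_le_carrier[OF yz]
  have "Ident Q (tp X x) \<preceq> hm X x z"
  proof (rule le_trans)
    show "Ident Q (tp X x) \<preceq> hm X x y" using xy unfolding qcat_le_def by blast
    show "hm X x y \<preceq> hm X x z" using qcat_le_hm_mono(1)[OF X yz] c by blast
    show "Ident Q (tp X x) \<in> hom_set Q (tp X x) (tp X x)" using qcat_Ident_hom[OF X] c by blast
    show "hm X x y \<in> hom_set Q (tp X x) (tp X x)" "hm X x z \<in> hom_set Q (tp X x) (tp X x)"
      using qcat_hm[OF X, of x y] qcat_hm[OF X, of x z] c by simp_all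
  qed
  then show ?thesis using c by (simp add: qcat_le_def)
qed

lemma qfunctor_mono:
  assumes f: "qfunctor Q X Y f" and le: "qcat_le Q X x x'"
  shows "qcat_le Q Y (f x) (f x')"
proof -
  note c = qcat_le_carrier[OF le]
  have "Ident Q (tp X x) \<preceq> hm Y (f x) (f x')"
  proof (rule le_trans)
    show "Ident Q (tp X x) \<preceq> hm X x x'" using le unfolding qcat_le_def by blast
    show "hm X x x' \<preceq> hm Y (f x) (f x')" using qfunctor_hm[OF f] c by blast
    show "Ident Q (tp X x) \<in> hom_set Q (tp X x) (tp X x)"
      using qcat_Ident_hom[OF qfunctor_dom[OF f]] c by blast
    show "hm X x x' \<in> hom_set Q (tp X x) (tp X x)"
      using qcat_hm[OF qfunctor_dom[OF f], of x x'] c by simp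
    show "hm Y (f x) (f x') \<in> hom_set Q (tp X x) (tp X x)"
      using qfunctor_hom[OF f, of x x'] c by simp
  qed
  then show ?thesis using c qfunctor_carrier[OF f] qfunctor_tp[OF f] by (simp add: qcat_le_def)
qed

text \<open>Composing with the identity of \<open>{s}\<close> changes nothing, so a distributor into \<open>{s}\<close> is a family
  with a contravariant action of the homs of \<open>X\<close> on it.\<close>

lemma carrier_PSh_iff:
  assumes X: "is_qcat Q X"
  shows "p \<in> carrier (PSh Q X) \<longleftrightarrow> fst p \<in> Obj Q \<and> snd p \<in> extensional (carrier X) \<and>
    (\<forall>x\<in>carrier X. p \<bullet> x \<in> hom_set Q (tp X x) (fst p)) \<and>
    (\<forall>x\<in>carrier X. \<forall>x'\<in>carrier X. p \<bullet> x' \<cdot> hm X x x' \<preceq> p \<bullet> x)" (is "_ \<longleftrightarrow> ?R")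
proof -
  obtain s \<sigma> where p: "p = (s, \<sigma>)" by (cases p)
  have q: "\<sigma> \<in> qrel Q X (one_qcat Q s) \<longleftrightarrow> \<sigma> \<in> extensional (carrier X) \<and>
      (\<forall>x\<in>carrier X. \<sigma> x () \<in> hom_set Q (tp X x) s)"
    by (auto simp: qrel_def one_qcat_def PiE_iff extensional_def)
  have "qrel_comp Q X (one_qcat Q s) (one_qcat Q s) (hm (one_qcat Q s))
         (qrel_comp Q X X (one_qcat Q s) \<sigma> (hm X)) x () \<preceq> \<sigma> x ()
      \<longleftrightarrow> (\<forall>x'\<in>carrier X. \<sigma> x' () \<cdot> hm X x x' \<preceq> \<sigma> x ())"
    if s: "s \<in> Obj Q" and h: "\<forall>x\<in>carrier X. \<sigma> x () \<in> hom_set Q (tp X x) s" and x: "x \<in> carrier X" for x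
  proof -
    let ?c = "qrel_comp Q X X (one_qcat Q s) \<sigma> (hm X) x ()"
    have xx: "\<And>x'. x' \<in> carrier X \<Longrightarrow> \<sigma> x' () \<cdot> hm X x x' \<in> hom_set Q (tp X x) (tp (one_qcat Q s) ())"
      using Comp_hom[OF qcat_hm[OF X x]] h by (simp add: one_qcat_def)
    have c: "?c \<in> hom_set Q (tp X x) s"
      using qrel_comp_hom[of x X "()" "one_qcat Q s" X \<sigma> "hm X"] xx x s qcat_tp[OF X x]
      by (simp add: one_qcat_def)
    have i: "Ident Q s \<cdot> ?c = ?c" by (rule Ident_Comp[OF c])
    have "qrel_comp Q X (one_qcat Q s) (one_qcat Q s) (hm (one_qcat Q s))
         (qrel_comp Q X X (one_qcat Q s) \<sigma> (hm X)) x () \<preceq> \<sigma> x () \<longleftrightarrow> ?c \<preceq> \<sigma> x ()"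
      using qrel_comp_le_iff[of x X "()" "one_qcat Q s" "\<sigma> x ()" "one_qcat Q s"
          "hm (one_qcat Q s)" "qrel_comp Q X X (one_qcat Q s) \<sigma> (hm X)"] c h x i
      by (simp add: one_qcat_def)
    also have "\<dots> \<longleftrightarrow> (\<forall>x'\<in>carrier X. \<sigma> x' () \<cdot> hm X x x' \<preceq> \<sigma> x ())"
      using qrel_comp_le_iff[of x X "()" "one_qcat Q s" "\<sigma> x ()" X \<sigma> "hm X"] xx h x
      by (simp add: one_qcat_def)
    finally show ?thesis .
  qed
  then show ?thesis
    using q unfolding p PSh_def Let_def distributors_def qrel_le_def
    by (auto simp: one_qcat_def)
qed

lemma carrier_CoPSh_iff:
  assumes X: "is_qcat Q X"
  shows "p \<in> carrier (CoPSh Q X) \<longleftrightarrow> fst p \<in> Obj Q \<and> snd p () \<in> extensional (carrier X) \<and>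
    (\<forall>x\<in>carrier X. p \<star> x \<in> hom_set Q (fst p) (tp X x)) \<and>
    (\<forall>x\<in>carrier X. \<forall>x'\<in>carrier X. hm X x x' \<cdot> p \<star> x \<preceq> p \<star> x')" (is "_ \<longleftrightarrow> ?R")
proof -
  obtain s \<sigma> where p: "p = (s, \<sigma>)" by (cases p)
  have q: "\<sigma> \<in> qrel Q (one_qcat Q s) X \<longleftrightarrow> \<sigma> () \<in> extensional (carrier X) \<and>
      (\<forall>x\<in>carrier X. \<sigma> () x \<in> hom_set Q s (tp X x))"
    by (auto simp: qrel_def one_qcat_def PiE_iff extensional_def)
  have "qrel_comp Q (one_qcat Q s) X X (hm X)
         (qrel_comp Q (one_qcat Q s) (one_qcat Q s) X \<sigma> (hm (one_qcat Q s))) () x' \<preceq> \<sigma> () x'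
      \<longleftrightarrow> (\<forall>x\<in>carrier X. hm X x x' \<cdot> \<sigma> () x \<preceq> \<sigma> () x')"
    if s: "s \<in> Obj Q" and h: "\<forall>x\<in>carrier X. \<sigma> () x \<in> hom_set Q s (tp X x)" and x: "x' \<in> carrier X" for x'
  proof -
    let ?c = "qrel_comp Q (one_qcat Q s) (one_qcat Q s) X \<sigma> (hm (one_qcat Q s)) ()"
    have c: "?c x = \<sigma> () x" if x: "x \<in> carrier X" for x
    proof -
      have "\<sigma> () x \<in> hom_set Q s (tp X x)" using h x by blast
      then show ?thesis using x by (simp add: qrel_comp_def one_qcat_def Comp_Ident Sup_singleton)
    qed
    have xx: "\<And>x. x \<in> carrier X \<Longrightarrow> hm X x x' \<cdot> ?c x \<in> hom_set Q (tp (one_qcat Q s) ()) (tp X x')"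
      using Comp_hom[OF _ qcat_hm[OF X _ x]] h c by (simp add: one_qcat_def)
    show ?thesis
      using qrel_comp_le_iff[of "()" "one_qcat Q s" x' X "\<sigma> () x'" X "hm X"
          "qrel_comp Q (one_qcat Q s) (one_qcat Q s) X \<sigma> (hm (one_qcat Q s))"] xx h x c
      by (simp add: one_qcat_def)
  qed
  then show ?thesis
    using q unfolding p CoPSh_def Let_def distributors_def qrel_le_def
    by (auto simp: one_qcat_def)
qed

lemma tp_PSh [simp]: "tp (PSh Q X) = fst"
  by (simp add: PSh_def Let_def)

lemma tp_CoPSh [simp]: "tp (CoPSh Q X) = fst"
  by (simp add: CoPSh_def Let_def)

lemma PSh_Obj: "is_qcat Q X \<Longrightarrow> p \<in> carrier (PSh Q X) \<Longrightarrow> fst p \<in> Obj Q"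
  and PSh_hom: "is_qcat Q X \<Longrightarrow> p \<in> carrier (PSh Q X) \<Longrightarrow> x \<in> carrier X \<Longrightarrow>
    p \<bullet> x \<in> hom_set Q (tp X x) (fst p)"
  and PSh_act: "is_qcat Q X \<Longrightarrow> p \<in> carrier (PSh Q X) \<Longrightarrow> x \<in> carrier X \<Longrightarrow> x' \<in> carrier X \<Longrightarrow>
    p \<bullet> x' \<cdot> hm X x x' \<preceq> p \<bullet> x"
  by (auto simp: carrier_PSh_iff)

lemma CoPSh_Obj: "is_qcat Q X \<Longrightarrow> p \<in> carrier (CoPSh Q X) \<Longrightarrow> fst p \<in> Obj Q"
  and CoPSh_hom: "is_qcat Q X \<Longrightarrow> p \<in> carrier (CoPSh Q X) \<Longrightarrow> x \<in> carrier X \<Longrightarrow>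
    p \<star> x \<in> hom_set Q (fst p) (tp X x)"
  and CoPSh_act: "is_qcat Q X \<Longrightarrow> p \<in> carrier (CoPSh Q X) \<Longrightarrow> x \<in> carrier X \<Longrightarrow> x' \<in> carrier X \<Longrightarrow>
    hm X x x' \<cdot> p \<star> x \<preceq> p \<star> x'"
  by (auto simp: carrier_CoPSh_iff)

lemma PSh_eqI:
  assumes X: "is_qcat Q X" and p: "p \<in> carrier (PSh Q X)" "p' \<in> carrier (PSh Q X)"
    and "fst p = fst p'" and eq: "\<And>x. x \<in> carrier X \<Longrightarrow> p \<bullet> x = p' \<bullet> x"
  shows "p = p'"
proof -
  have "snd p = snd p'"
  proof (rule extensionalityI[of _ "carrier X"])
    show "snd p x = snd p' x" if "x \<in> carrier X" for x
      using eq[OF that] by (auto simp: fun_eq_iff)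
  qed (use p X in \<open>auto simp: carrier_PSh_iff\<close>)
  then show ?thesis using assms(4) by (simp add: prod_eq_iff)
qed

lemma CoPSh_eqI:
  assumes X: "is_qcat Q X" and p: "p \<in> carrier (CoPSh Q X)" "p' \<in> carrier (CoPSh Q X)"
    and "fst p = fst p'" and eq: "\<And>x. x \<in> carrier X \<Longrightarrow> p \<star> x = p' \<star> x"
  shows "p = p'"
proof -
  have "snd p () = snd p' ()"
    by (rule extensionalityI[of _ "carrier X"]) (use p X eq in \<open>auto simp: carrier_CoPSh_iff\<close>)
  then have "snd p = snd p'" by (auto simp: fun_eq_iff)
  then show ?thesis using assms(4) by (simp add: prod_eq_iff)
qed

lemma
  assumes X: "is_qcat Q X" and p: "p \<in> carrier (PSh Q X)" "p' \<in> carrier (PSh Q X)"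
  shows hm_PSh_hom: "hm (PSh Q X) p p' \<in> hom_set Q (fst p) (fst p')"
    and le_hm_PSh_iff: "u \<in> hom_set Q (fst p) (fst p') \<Longrightarrow>
      u \<preceq> hm (PSh Q X) p p' \<longleftrightarrow> (\<forall>x\<in>carrier X. u \<cdot> p \<bullet> x \<preceq> p' \<bullet> x)"
proof -
  have e: "hm (PSh Q X) p p' = \<Sqinter>\<^bsub>Hom Q (fst p) (fst p')\<^esub> ((\<lambda>x. p' \<bullet> x \<swarrow> p \<bullet> x) ` carrier X)"
    using p by (simp add: PSh_def Let_def)
  have s: "(\<lambda>x. p' \<bullet> x \<swarrow> p \<bullet> x) ` carrier X \<subseteq> hom_set Q (fst p) (fst p')"
    using lres_hom[OF PSh_hom[OF X p(1)] PSh_hom[OF X p(2)]] by blast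
  note ob = PSh_Obj[OF X p(1)] PSh_Obj[OF X p(2)]
  show "hm (PSh Q X) p p' \<in> hom_set Q (fst p) (fst p')"
    unfolding e by (rule Inf_hom[OF ob s])
  show "u \<preceq> hm (PSh Q X) p p' \<longleftrightarrow> (\<forall>x\<in>carrier X. u \<cdot> p \<bullet> x \<preceq> p' \<bullet> x)"
    if u: "u \<in> hom_set Q (fst p) (fst p')"
    unfolding e le_Inf_iff[OF ob s u] using le_lres_iff[OF PSh_hom[OF X p(1)] PSh_hom[OF X p(2)] u] by simp
qed

lemma
  assumes X: "is_qcat Q X" and p: "p \<in> carrier (CoPSh Q X)" "p' \<in> carrier (CoPSh Q X)"
  shows hm_CoPSh_hom: "hm (CoPSh Q X) p p' \<in> hom_set Q (fst p) (fst p')"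
    and le_hm_CoPSh_iff: "u \<in> hom_set Q (fst p) (fst p') \<Longrightarrow>
      u \<preceq> hm (CoPSh Q X) p p' \<longleftrightarrow> (\<forall>x\<in>carrier X. p' \<star> x \<cdot> u \<preceq> p \<star> x)"
proof -
  have e: "hm (CoPSh Q X) p p' = \<Sqinter>\<^bsub>Hom Q (fst p) (fst p')\<^esub> ((\<lambda>x. p' \<star> x \<searrow> p \<star> x) ` carrier X)"
    using p by (simp add: CoPSh_def Let_def)
  have s: "(\<lambda>x. p' \<star> x \<searrow> p \<star> x) ` carrier X \<subseteq> hom_set Q (fst p) (fst p')"
    using rres_hom[OF CoPSh_hom[OF X p(2)] CoPSh_hom[OF X p(1)]] by blast
  note ob = CoPSh_Obj[OF X p(1)] CoPSh_Obj[OF X p(2)]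
  show "hm (CoPSh Q X) p p' \<in> hom_set Q (fst p) (fst p')"
    unfolding e by (rule Inf_hom[OF ob s])
  show "u \<preceq> hm (CoPSh Q X) p p' \<longleftrightarrow> (\<forall>x\<in>carrier X. p' \<star> x \<cdot> u \<preceq> p \<star> x)"
    if u: "u \<in> hom_set Q (fst p) (fst p')"
    unfolding e le_Inf_iff[OF ob s u] using le_rres_iff[OF CoPSh_hom[OF X p(2)] CoPSh_hom[OF X p(1)] u] by simp
qed

lemma hm_PSh_at:
  assumes X: "is_qcat Q X" and p: "p \<in> carrier (PSh Q X)" "p' \<in> carrier (PSh Q X)"
    and x: "x \<in> carrier X"
  shows "hm (PSh Q X) p p' \<cdot> p \<bullet> x \<preceq> p' \<bullet> x"
  using le_hm_PSh_iff[OF X p hm_PSh_hom[OF X p]] le_refl[OF hm_PSh_hom[OF X p]] x by blast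

lemma hm_CoPSh_at:
  assumes X: "is_qcat Q X" and p: "p \<in> carrier (CoPSh Q X)" "p' \<in> carrier (CoPSh Q X)"
    and x: "x \<in> carrier X"
  shows "p' \<star> x \<cdot> hm (CoPSh Q X) p p' \<preceq> p \<star> x"
  using le_hm_CoPSh_iff[OF X p hm_CoPSh_hom[OF X p]] le_refl[OF hm_CoPSh_hom[OF X p]] x by blast

lemma is_qcat_PSh:
  assumes X: "is_qcat Q X"
  shows "is_qcat Q (PSh Q X)"
proof (rule is_qcatI)
  show "tp (PSh Q X) \<in> carrier (PSh Q X) \<rightarrow> Obj Q" using PSh_Obj X by auto
  have "hm (PSh Q X) \<in> extensional (carrier (PSh Q X))"
    "\<And>p. p \<in> carrier (PSh Q X) \<Longrightarrow> hm (PSh Q X) p \<in> extensional (carrier (PSh Q X))"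
    by (simp_all add: PSh_def Let_def)
  then show "hm (PSh Q X) \<in> qrel Q (PSh Q X) (PSh Q X)"
    using hm_PSh_hom[OF X] by (simp add: qrel_def PiE_iff)
  show "Ident Q (tp (PSh Q X) p) \<preceq> hm (PSh Q X) p p" if p: "p \<in> carrier (PSh Q X)" for p
    using le_hm_PSh_iff[OF X p p Ident_hom] PSh_Obj[OF X p] Ident_Comp[OF PSh_hom[OF X p]]
      le_refl[OF PSh_hom[OF X p]] by simp
  show "hm (PSh Q X) q r \<cdot> hm (PSh Q X) p q \<preceq> hm (PSh Q X) p r"
    if p: "p \<in> carrier (PSh Q X)" and q: "q \<in> carrier (PSh Q X)" and r: "r \<in> carrier (PSh Q X)"
    for p q r
  proof -
    note pq = hm_PSh_hom[OF X p q] and qr = hm_PSh_hom[OF X q r]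
    have "hm (PSh Q X) q r \<cdot> hm (PSh Q X) p q \<cdot> p \<bullet> x \<preceq> r \<bullet> x" if x: "x \<in> carrier X" for x
    proof -
      note px = PSh_hom[OF X p x] and qx = PSh_hom[OF X q x] and rx = PSh_hom[OF X r x]
      have "hm (PSh Q X) q r \<cdot> (hm (PSh Q X) p q \<cdot> p \<bullet> x) \<preceq> r \<bullet> x"
        by (rule le_trans[OF Comp_mono_right[OF hm_PSh_at[OF X p q x] Comp_hom[OF px pq] qx qr]
              hm_PSh_at[OF X q r x] Comp_hom[OF Comp_hom[OF px pq] qr] Comp_hom[OF qx qr] rx])
      then show ?thesis using Comp_assoc[OF px pq qr] by simp
    qed
    then show ?thesis using le_hm_PSh_iff[OF X p r Comp_hom[OF pq qr]] by blast
  qed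
qed

lemma is_qcat_CoPSh:
  assumes X: "is_qcat Q X"
  shows "is_qcat Q (CoPSh Q X)"
proof (rule is_qcatI)
  show "tp (CoPSh Q X) \<in> carrier (CoPSh Q X) \<rightarrow> Obj Q" using CoPSh_Obj X by auto
  have "hm (CoPSh Q X) \<in> extensional (carrier (CoPSh Q X))"
    "\<And>p. p \<in> carrier (CoPSh Q X) \<Longrightarrow> hm (CoPSh Q X) p \<in> extensional (carrier (CoPSh Q X))"
    by (simp_all add: CoPSh_def Let_def)
  then show "hm (CoPSh Q X) \<in> qrel Q (CoPSh Q X) (CoPSh Q X)"
    using hm_CoPSh_hom[OF X] by (simp add: qrel_def PiE_iff)
  show "Ident Q (tp (CoPSh Q X) p) \<preceq> hm (CoPSh Q X) p p" if p: "p \<in> carrier (CoPSh Q X)" for p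
    using le_hm_CoPSh_iff[OF X p p Ident_hom] CoPSh_Obj[OF X p] Comp_Ident[OF CoPSh_hom[OF X p]]
      le_refl[OF CoPSh_hom[OF X p]] by simp
  show "hm (CoPSh Q X) q r \<cdot> hm (CoPSh Q X) p q \<preceq> hm (CoPSh Q X) p r"
    if p: "p \<in> carrier (CoPSh Q X)" and q: "q \<in> carrier (CoPSh Q X)" and r: "r \<in> carrier (CoPSh Q X)"
    for p q r
  proof -
    note pq = hm_CoPSh_hom[OF X p q] and qr = hm_CoPSh_hom[OF X q r]
    have "r \<star> x \<cdot> (hm (CoPSh Q X) q r \<cdot> hm (CoPSh Q X) p q) \<preceq> p \<star> x" if x: "x \<in> carrier X" for x
    proof -
      note px = CoPSh_hom[OF X p x] and qx = CoPSh_hom[OF X q x] and rx = CoPSh_hom[OF X r x]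
      have "(r \<star> x \<cdot> hm (CoPSh Q X) q r) \<cdot> hm (CoPSh Q X) p q \<preceq> p \<star> x"
        by (rule le_trans[OF Comp_mono_left[OF hm_CoPSh_at[OF X q r x] pq Comp_hom[OF qr rx] qx]
              hm_CoPSh_at[OF X p q x] Comp_hom[OF pq Comp_hom[OF qr rx]] Comp_hom[OF pq qx] px])
      then show ?thesis using Comp_assoc[OF pq qr rx] by simp
    qed
    then show ?thesis using le_hm_CoPSh_iff[OF X p r Comp_hom[OF pq qr]] by blast
  qed
qed

lemma qcat_le_PSh_iff:
  assumes X: "is_qcat Q X"
  shows "qcat_le Q (PSh Q X) p p' \<longleftrightarrow> p \<in> carrier (PSh Q X) \<and> p' \<in> carrier (PSh Q X) \<and>
    fst p = fst p' \<and> (\<forall>x\<in>carrier X. p \<bullet> x \<preceq> p' \<bullet> x)"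
proof -
  have "Ident Q (fst p) \<preceq> hm (PSh Q X) p p' \<longleftrightarrow> (\<forall>x\<in>carrier X. p \<bullet> x \<preceq> p' \<bullet> x)"
    if p: "p \<in> carrier (PSh Q X)" "p' \<in> carrier (PSh Q X)" and e: "fst p = fst p'"
    using le_hm_PSh_iff[OF X p, of "Ident Q (fst p)"] Ident_hom[OF PSh_Obj[OF X p(1)]]
      Ident_Comp[OF PSh_hom[OF X p(1)]] e by simp
  then show ?thesis by (auto simp: qcat_le_def)
qed

lemma qcat_le_CoPSh_iff:
  assumes X: "is_qcat Q X"
  shows "qcat_le Q (CoPSh Q X) p p' \<longleftrightarrow> p \<in> carrier (CoPSh Q X) \<and> p' \<in> carrier (CoPSh Q X) \<and>
    fst p = fst p' \<and> (\<forall>x\<in>carrier X. p' \<star> x \<preceq> p \<star> x)"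
proof -
  have "Ident Q (fst p) \<preceq> hm (CoPSh Q X) p p' \<longleftrightarrow> (\<forall>x\<in>carrier X. p' \<star> x \<preceq> p \<star> x)"
    if p: "p \<in> carrier (CoPSh Q X)" "p' \<in> carrier (CoPSh Q X)" and e: "fst p = fst p'"
    using le_hm_CoPSh_iff[OF X p, of "Ident Q (fst p)"] Ident_hom[OF CoPSh_Obj[OF X p(1)]]
      Comp_Ident[OF CoPSh_hom[OF X p(2)]] e by simp
  then show ?thesis by (auto simp: qcat_le_def)
qed

text \<open>Presheaf categories are separated, unlike general categories over \<open>Q\<close>.  This allows equalities
  of presheaves to be proved from universal properties.\<close>

lemma PSh_antisym:
  assumes X: "is_qcat Q X" and le: "qcat_le Q (PSh Q X) p p'" "qcat_le Q (PSh Q X) p' p"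
  shows "p = p'"
proof (rule PSh_eqI[OF X])
  note le' = le[unfolded qcat_le_PSh_iff[OF X]]
  then show p: "p \<in> carrier (PSh Q X)" "p' \<in> carrier (PSh Q X)" "fst p = fst p'" by auto
  show "p \<bullet> x = p' \<bullet> x" if x: "x \<in> carrier X" for x
  proof (rule le_antisym)
    show "p \<bullet> x \<preceq> p' \<bullet> x" "p' \<bullet> x \<preceq> p \<bullet> x" using le' x by blast+
    show "p \<bullet> x \<in> hom_set Q (tp X x) (fst p)" "p' \<bullet> x \<in> hom_set Q (tp X x) (fst p)"
      using PSh_hom[OF X p(1) x] PSh_hom[OF X p(2) x] p(3) by simp_all
  qed
qed

lemma CoPSh_antisym:
  assumes X: "is_qcat Q X" and le: "qcat_le Q (CoPSh Q X) p p'" "qcat_le Q (CoPSh Q X) p' p"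
  shows "p = p'"
proof (rule CoPSh_eqI[OF X])
  note le' = le[unfolded qcat_le_CoPSh_iff[OF X]]
  then show p: "p \<in> carrier (CoPSh Q X)" "p' \<in> carrier (CoPSh Q X)" "fst p = fst p'" by auto
  show "p \<star> x = p' \<star> x" if x: "x \<in> carrier X" for x
  proof (rule le_antisym)
    show "p \<star> x \<preceq> p' \<star> x" "p' \<star> x \<preceq> p \<star> x" using le' x by blast+
    show "p \<star> x \<in> hom_set Q (fst p) (tp X x)" "p' \<star> x \<in> hom_set Q (fst p) (tp X x)"
      using CoPSh_hom[OF X p(1) x] CoPSh_hom[OF X p(2) x] p(3) by simp_all
  qed
qed

end

section \<open>Direct images, inverse images and the Yoneda lemma\<close>

definition fully_faithful :: "('a, 'o, 'm) qcat \<Rightarrow> ('b, 'o, 'm) qcat \<Rightarrow> ('a \<Rightarrow> 'b) \<Rightarrow> bool" where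
  "fully_faithful X Y f \<longleftrightarrow> (\<forall>x\<in>carrier X. \<forall>x'\<in>carrier X. hm Y (f x) (f x') = hm X x x')"

text \<open>This is \<open>\<tau> \<mapsto> f\<^sup>* \<circ> \<tau>\<close>, with the composite already evaluated by the Yoneda lemma.\<close>

definition copsh_pull :: "('a, 'o, 'm) qcat \<Rightarrow> ('a \<Rightarrow> 'b) \<Rightarrow> ('b, 'o, 'm) copsh \<Rightarrow> ('a, 'o, 'm) copsh" where
  "copsh_pull X f q = (fst q, \<lambda>_. \<lambda>x\<in>carrier X. q \<star> f x)"

lemma fst_psh_push [simp]: "fst (psh_push Q X Y f p) = fst p"
  by (cases p) (simp add: psh_push_def)

lemma fst_psh_pull [simp]: "fst (psh_pull Q X Y f p) = fst p"
  by (cases p) (simp add: psh_pull_def)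

lemma fst_copsh_push [simp]: "fst (copsh_push Q X Y f p) = fst p"
  by (cases p) (simp add: copsh_push_def)

lemma fst_copsh_pull [simp]: "fst (copsh_pull X f p) = fst p"
  by (simp add: copsh_pull_def)

lemma fst_yoneda [simp]: "fst (yoneda X x) = tp X x"
  by (simp add: yoneda_def)

lemma fst_coyoneda [simp]: "fst (coyoneda X x) = tp X x"
  by (simp add: coyoneda_def)

lemma yoneda_at [simp]: "x' \<in> carrier X \<Longrightarrow> yoneda X x \<bullet> x' = hm X x' x"
  by (simp add: yoneda_def)

lemma coyoneda_at [simp]: "x' \<in> carrier X \<Longrightarrow> coyoneda X x \<star> x' = hm X x x'"
  by (simp add: coyoneda_def)

lemma copsh_pull_at [simp]: "x \<in> carrier X \<Longrightarrow> copsh_pull X f q \<star> x = q \<star> f x"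
  by (simp add: copsh_pull_def)

lemma psh_push_at:
  "y \<in> carrier Y \<Longrightarrow> psh_push Q X Y f p \<bullet> y =
    \<Squnion>\<^bsub>Hom Q (tp Y y) (fst p)\<^esub> ((\<lambda>x. p \<bullet> x \<cdot>\<^bsub>Q\<^esub> hm Y y (f x)) ` carrier X)"
  by (cases p) (auto simp: psh_push_def qrel_comp_def one_qcat_def cograph_def)

lemma copsh_push_at:
  "y \<in> carrier Y \<Longrightarrow> copsh_push Q X Y f p \<star> y =
    \<Squnion>\<^bsub>Hom Q (fst p) (tp Y y)\<^esub> ((\<lambda>x. hm Y (f x) y \<cdot>\<^bsub>Q\<^esub> p \<star> x) ` carrier X)"
  by (cases p) (auto simp: copsh_push_def qrel_comp_def one_qcat_def graph_def)

lemma psh_pull_at_Sup: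
  "x \<in> carrier X \<Longrightarrow> psh_pull Q X Y f q \<bullet> x =
    \<Squnion>\<^bsub>Hom Q (tp X x) (fst q)\<^esub> ((\<lambda>y. q \<bullet> y \<cdot>\<^bsub>Q\<^esub> hm Y (f x) y) ` carrier Y)"
  by (cases q) (auto simp: psh_pull_def qrel_comp_def one_qcat_def graph_def)

lemma psh_push_cong: "(\<And>x. x \<in> carrier X \<Longrightarrow> f x = g x) \<Longrightarrow> psh_push Q X Y f = psh_push Q X Y g"
proof -
  assume "\<And>x. x \<in> carrier X \<Longrightarrow> f x = g x"
  then have "cograph X Y f = cograph X Y g"
    by (auto simp: cograph_def fun_eq_iff restrict_def)
  then show ?thesis by (simp add: psh_push_def)
qed

lemma copsh_push_cong:
  "(\<And>x. x \<in> carrier X \<Longrightarrow> f x = g x) \<Longrightarrow> copsh_push Q X Y f = copsh_push Q X Y g"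
proof -
  assume "\<And>x. x \<in> carrier X \<Longrightarrow> f x = g x"
  then have "graph X Y f = graph X Y g"
    by (auto simp: graph_def fun_eq_iff restrict_def)
  then show ?thesis by (simp add: copsh_push_def)
qed

context quantaloid
begin

lemma PSh_antitone:
  assumes X: "is_qcat Q X" and p: "p \<in> carrier (PSh Q X)" and le: "qcat_le Q X x x'"
  shows "p \<bullet> x' \<preceq> p \<bullet> x"
proof -
  have x: "x \<in> carrier X" and x': "x' \<in> carrier X" and t: "tp X x' = tp X x"
    and i: "Ident Q (tp X x) \<preceq> hm X x x'" using le unfolding qcat_le_def by auto
  have px: "p \<bullet> x' \<in> hom_set Q (tp X x) (fst p)" and h: "hm X x x' \<in> hom_set Q (tp X x) (tp X x)"
    using PSh_hom[OF X p x'] qcat_hm[OF X x x'] t by simp_all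
  have "p \<bullet> x' \<cdot> Ident Q (tp X x) \<preceq> p \<bullet> x"
    by (rule le_trans[OF Comp_mono_right[OF i qcat_Ident_hom[OF X x] h px] PSh_act[OF X p x x']
        Comp_hom[OF qcat_Ident_hom[OF X x] px] Comp_hom[OF h px] PSh_hom[OF X p x]])
  then show ?thesis using Comp_Ident[OF px] by simp
qed

lemma CoPSh_monotone:
  assumes X: "is_qcat Q X" and p: "p \<in> carrier (CoPSh Q X)" and le: "qcat_le Q X x x'"
  shows "p \<star> x \<preceq> p \<star> x'"
proof -
  have x: "x \<in> carrier X" and x': "x' \<in> carrier X" and t: "tp X x' = tp X x"
    and i: "Ident Q (tp X x) \<preceq> hm X x x'" using le unfolding qcat_le_def by auto
  have px: "p \<star> x' \<in> hom_set Q (fst p) (tp X x)" and h: "hm X x x' \<in> hom_set Q (tp X x) (tp X x)"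
    using CoPSh_hom[OF X p x'] qcat_hm[OF X x x'] t by simp_all
  note q = CoPSh_hom[OF X p x]
  have "Ident Q (tp X x) \<cdot> p \<star> x \<preceq> p \<star> x'"
    by (rule le_trans[OF Comp_mono_left[OF i q qcat_Ident_hom[OF X x] h] CoPSh_act[OF X p x x']
        Comp_hom[OF q qcat_Ident_hom[OF X x]] Comp_hom[OF q h] px])
  then show ?thesis using Ident_Comp[OF q] by simp
qed

lemma carrier_yoneda:
  assumes X: "is_qcat Q X" and x: "x \<in> carrier X"
  shows "yoneda X x \<in> carrier (PSh Q X)"
proof -
  have "snd (yoneda X x) \<in> extensional (carrier X)" by (simp add: yoneda_def)
  then show ?thesis
    using qcat_tp[OF X x] qcat_hm[OF X _ x] qcat_comp[OF X _ _ x] by (simp add: carrier_PSh_iff[OF X])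
qed

lemma carrier_coyoneda:
  assumes X: "is_qcat Q X" and x: "x \<in> carrier X"
  shows "coyoneda X x \<in> carrier (CoPSh Q X)"
proof -
  have "snd (coyoneda X x) () \<in> extensional (carrier X)" by (simp add: coyoneda_def)
  then show ?thesis
    using qcat_tp[OF X x] qcat_hm[OF X x] qcat_comp[OF X x] by (simp add: carrier_CoPSh_iff[OF X])
qed

text \<open>An arrow \<open>u \<preceq> p(x)\<close> acts along the homs into \<open>x\<close> to give \<open>u \<cdot> 1\<^sup>*(x', x) \<preceq> p(x')\<close>; conversely
  evaluate at \<open>x' = x\<close>, where the hom lies above the identity.\<close>

lemma Yoneda:
  assumes X: "is_qcat Q X" and x: "x \<in> carrier X" and p: "p \<in> carrier (PSh Q X)"
  shows "hm (PSh Q X) (yoneda X x) p = p \<bullet> x"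
proof (rule hom_eqI_below)
  note yx = carrier_yoneda[OF X x] and px = PSh_hom[OF X p x]
  show "hm (PSh Q X) (yoneda X x) p \<in> hom_set Q (tp X x) (fst p)" using hm_PSh_hom[OF X yx p] by simp
  show "p \<bullet> x \<in> hom_set Q (tp X x) (fst p)" by (rule px)
  fix u assume u: "u \<in> hom_set Q (tp X x) (fst p)"
  then have "u \<preceq> hm (PSh Q X) (yoneda X x) p \<longleftrightarrow> (\<forall>x'\<in>carrier X. u \<cdot> hm X x' x \<preceq> p \<bullet> x')"
    using le_hm_PSh_iff[OF X yx p] by simp
  also have "\<dots> \<longleftrightarrow> u \<preceq> p \<bullet> x"
  proof safe
    assume "\<forall>x'\<in>carrier X. u \<cdot> hm X x' x \<preceq> p \<bullet> x'"
    then have 1: "u \<cdot> hm X x x \<preceq> p \<bullet> x" using x by blast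
    note i = qcat_Ident_hom[OF X x] and h = qcat_hm[OF X x x]
    have "u \<cdot> Ident Q (tp X x) \<preceq> p \<bullet> x"
      by (rule le_trans[OF Comp_mono_right[OF qcat_Ident[OF X x] i h u] 1
            Comp_hom[OF i u] Comp_hom[OF h u] px])
    then show "u \<preceq> p \<bullet> x" using Comp_Ident[OF u] by simp
  next
    fix x' assume le: "u \<preceq> p \<bullet> x" and x': "x' \<in> carrier X"
    note h = qcat_hm[OF X x' x]
    show "u \<cdot> hm X x' x \<preceq> p \<bullet> x'"
      by (rule le_trans[OF Comp_mono_left[OF le h u px] PSh_act[OF X p x' x]
            Comp_hom[OF h u] Comp_hom[OF h px] PSh_hom[OF X p x']])
  qed
  finally show "u \<preceq> hm (PSh Q X) (yoneda X x) p \<longleftrightarrow> u \<preceq> p \<bullet> x" .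
qed

lemma coYoneda:
  assumes X: "is_qcat Q X" and x: "x \<in> carrier X" and p: "p \<in> carrier (CoPSh Q X)"
  shows "hm (CoPSh Q X) p (coyoneda X x) = p \<star> x"
proof (rule hom_eqI_below)
  note yx = carrier_coyoneda[OF X x] and px = CoPSh_hom[OF X p x]
  show "hm (CoPSh Q X) p (coyoneda X x) \<in> hom_set Q (fst p) (tp X x)"
    using hm_CoPSh_hom[OF X p yx] by simp
  show "p \<star> x \<in> hom_set Q (fst p) (tp X x)" by (rule px)
  fix u assume u: "u \<in> hom_set Q (fst p) (tp X x)"
  then have "u \<preceq> hm (CoPSh Q X) p (coyoneda X x) \<longleftrightarrow> (\<forall>x'\<in>carrier X. hm X x x' \<cdot> u \<preceq> p \<star> x')"
    using le_hm_CoPSh_iff[OF X p yx] by simp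
  also have "\<dots> \<longleftrightarrow> u \<preceq> p \<star> x"
  proof safe
    assume "\<forall>x'\<in>carrier X. hm X x x' \<cdot> u \<preceq> p \<star> x'"
    then have 1: "hm X x x \<cdot> u \<preceq> p \<star> x" using x by blast
    note i = qcat_Ident_hom[OF X x] and h = qcat_hm[OF X x x]
    have "Ident Q (tp X x) \<cdot> u \<preceq> p \<star> x"
      by (rule le_trans[OF Comp_mono_left[OF qcat_Ident[OF X x] u i h] 1
            Comp_hom[OF u i] Comp_hom[OF u h] px])
    then show "u \<preceq> p \<star> x" using Ident_Comp[OF u] by simp
  next
    fix x' assume le: "u \<preceq> p \<star> x" and x': "x' \<in> carrier X"
    note h = qcat_hm[OF X x x']
    show "hm X x x' \<cdot> u \<preceq> p \<star> x'"
      by (rule le_trans[OF Comp_mono_right[OF le u px h] CoPSh_act[OF X p x x']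
            Comp_hom[OF u h] Comp_hom[OF px h] CoPSh_hom[OF X p x']])
  qed
  finally show "u \<preceq> hm (CoPSh Q X) p (coyoneda X x) \<longleftrightarrow> u \<preceq> p \<star> x" .
qed

lemma qfunctorI_fully_faithful:
  assumes "is_qcat Q X" "is_qcat Q Y" "\<And>x. x \<in> carrier X \<Longrightarrow> f x \<in> carrier Y"
    and "\<And>x. x \<in> carrier X \<Longrightarrow> tp Y (f x) = tp X x" and "fully_faithful X Y f"
  shows "qfunctor Q X Y f"
  using assms le_refl[OF qcat_hm[OF assms(1)]] by (simp add: qfunctor_def fully_faithful_def)

lemma fully_faithful_yoneda: "is_qcat Q X \<Longrightarrow> fully_faithful X (PSh Q X) (yoneda X)"
  by (simp add: fully_faithful_def Yoneda carrier_yoneda)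

lemma qfunctor_yoneda: "is_qcat Q X \<Longrightarrow> qfunctor Q X (PSh Q X) (yoneda X)"
  by (simp add: qfunctorI_fully_faithful is_qcat_PSh carrier_yoneda fully_faithful_yoneda)

lemma qfunctor_coyoneda: "is_qcat Q X \<Longrightarrow> qfunctor Q X (CoPSh Q X) (coyoneda X)"
  by (simp add: qfunctorI_fully_faithful is_qcat_CoPSh carrier_coyoneda fully_faithful_def coYoneda)

text \<open>The supremum defining \<open>q \<circ> f\<^sub>*\<close> at \<open>x\<close> is attained at \<open>y = f x\<close>, so inverse image is
  precomposition with \<open>f\<close>.\<close>

lemma psh_pull_at:
  assumes f: "qfunctor Q X Y f" and q: "q \<in> carrier (PSh Q Y)" and x: "x \<in> carrier X"
  shows "psh_pull Q X Y f q \<bullet> x = q \<bullet> f x"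
proof -
  note Y = qfunctor_cod[OF f] and fx = qfunctor_carrier[OF f x] and t = qfunctor_tp[OF f x]
  have qf: "q \<bullet> f x \<in> hom_set Q (tp X x) (fst q)" using PSh_hom[OF Y q fx] t by simp
  note ob = hom_Obj[OF qf]
  let ?A = "(\<lambda>y. q \<bullet> y \<cdot> hm Y (f x) y) ` carrier Y"
  have A: "?A \<subseteq> hom_set Q (tp X x) (fst q)"
    using Comp_hom[OF qfunctor_hom_from[OF f x] PSh_hom[OF Y q]] by blast
  have le: "\<Squnion>\<^bsub>Hom Q (tp X x) (fst q)\<^esub> ?A \<preceq> q \<bullet> f x"
    using Sup_le_iff[OF _ _ A qf] ob PSh_act[OF Y q fx] by simp
  have "q \<bullet> f x \<cdot> Ident Q (tp X x) \<preceq> q \<bullet> f x \<cdot> hm Y (f x) (f x)"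
    by (rule Comp_mono_right[OF _ qcat_Ident_hom[OF qfunctor_dom[OF f] x] qfunctor_hom[OF f x x] qf])
      (use qcat_Ident[OF Y fx] t in simp)
  then have 1: "q \<bullet> f x \<preceq> q \<bullet> f x \<cdot> hm Y (f x) (f x)" using Comp_Ident[OF qf] by simp
  have ge: "q \<bullet> f x \<preceq> \<Squnion>\<^bsub>Hom Q (tp X x) (fst q)\<^esub> ?A"
    by (rule le_trans[OF 1 Sup_upper[OF _ _ A] qf]) (use ob fx A Sup_hom[OF _ _ A] in auto)
  show ?thesis unfolding psh_pull_at_Sup[OF x]
    by (rule le_antisym[OF le ge _ qf]) (use ob A Sup_hom in auto)
qed

lemma carrier_psh_pull:
  assumes f: "qfunctor Q X Y f" and q: "q \<in> carrier (PSh Q Y)"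
  shows "psh_pull Q X Y f q \<in> carrier (PSh Q X)"
proof -
  note Y = qfunctor_cod[OF f] and X = qfunctor_dom[OF f] and fx = qfunctor_carrier[OF f]
    and t = qfunctor_tp[OF f]
  have "snd (psh_pull Q X Y f q) \<in> extensional (carrier X)"
    by (cases q) (simp add: psh_pull_def qrel_comp_def)
  moreover have "q \<bullet> f x' \<cdot> hm X x x' \<preceq> q \<bullet> f x" if x: "x \<in> carrier X" "x' \<in> carrier X" for x x'
  proof -
    have qx: "q \<bullet> f x \<in> hom_set Q (tp X x) (fst q)" and qx': "q \<bullet> f x' \<in> hom_set Q (tp X x') (fst q)"
      using PSh_hom[OF Y q fx] t x by simp_all
    note h = qcat_hm[OF X x] and h' = qfunctor_hom[OF f x]
    show ?thesis
      by (rule le_trans[OF Comp_mono_right[OF qfunctor_hm[OF f x] h h' qx']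
            PSh_act[OF Y q fx[OF x(1)] fx[OF x(2)]] Comp_hom[OF h qx'] Comp_hom[OF h' qx'] qx])
  qed
  ultimately show ?thesis
    using PSh_Obj[OF Y q] PSh_hom[OF Y q fx] t psh_pull_at[OF f q] by (simp add: carrier_PSh_iff[OF X])
qed

lemma carrier_copsh_pull:
  assumes f: "qfunctor Q X Y f" and q: "q \<in> carrier (CoPSh Q Y)"
  shows "copsh_pull X f q \<in> carrier (CoPSh Q X)"
proof -
  note Y = qfunctor_cod[OF f] and X = qfunctor_dom[OF f] and fx = qfunctor_carrier[OF f]
    and t = qfunctor_tp[OF f]
  have "snd (copsh_pull X f q) () \<in> extensional (carrier X)"
    by (simp add: copsh_pull_def)
  moreover have "hm X x x' \<cdot> q \<star> f x \<preceq> q \<star> f x'" if x: "x \<in> carrier X" "x' \<in> carrier X" for x x'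
  proof -
    have qx: "q \<star> f x \<in> hom_set Q (fst q) (tp X x)" and qx': "q \<star> f x' \<in> hom_set Q (fst q) (tp X x')"
      using CoPSh_hom[OF Y q fx] t x by simp_all
    note h = qcat_hm[OF X x] and h' = qfunctor_hom[OF f x]
    show ?thesis
      by (rule le_trans[OF Comp_mono_left[OF qfunctor_hm[OF f x] qx h h']
            CoPSh_act[OF Y q fx[OF x(1)] fx[OF x(2)]] Comp_hom[OF qx h] Comp_hom[OF qx h'] qx'])
  qed
  ultimately show ?thesis
    using CoPSh_Obj[OF Y q] CoPSh_hom[OF Y q fx] t by (simp add: carrier_CoPSh_iff[OF X])
qed

lemma
  assumes f: "qfunctor Q X Y f" and p: "p \<in> carrier (PSh Q X)" and y: "y \<in> carrier Y"
  shows psh_push_hom: "psh_push Q X Y f p \<bullet> y \<in> hom_set Q (tp Y y) (fst p)"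
    and psh_push_at_le_iff: "w \<in> hom_set Q (tp Y y) (fst p) \<Longrightarrow>
      psh_push Q X Y f p \<bullet> y \<preceq> w \<longleftrightarrow> (\<forall>x\<in>carrier X. p \<bullet> x \<cdot> hm Y y (f x) \<preceq> w)"
    and Comp_psh_push_at_le_iff: "u \<in> hom_set Q (fst p) s \<Longrightarrow> w \<in> hom_set Q (tp Y y) s \<Longrightarrow>
      u \<cdot> psh_push Q X Y f p \<bullet> y \<preceq> w \<longleftrightarrow> (\<forall>x\<in>carrier X. u \<cdot> (p \<bullet> x \<cdot> hm Y y (f x)) \<preceq> w)"
    and psh_push_at_Comp_le_iff: "u \<in> hom_set Q s (tp Y y) \<Longrightarrow> w \<in> hom_set Q s (fst p) \<Longrightarrow>
      psh_push Q X Y f p \<bullet> y \<cdot> u \<preceq> w \<longleftrightarrow> (\<forall>x\<in>carrier X. p \<bullet> x \<cdot> hm Y y (f x) \<cdot> u \<preceq> w)"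
proof -
  note X = qfunctor_dom[OF f] and Y = qfunctor_cod[OF f]
  note ob = qcat_tp[OF Y y] PSh_Obj[OF X p]
  have A: "(\<lambda>x. p \<bullet> x \<cdot> hm Y y (f x)) ` carrier X \<subseteq> hom_set Q (tp Y y) (fst p)"
    using Comp_hom[OF qfunctor_hom_to[OF f _ y] PSh_hom[OF X p]] by blast
  show "psh_push Q X Y f p \<bullet> y \<in> hom_set Q (tp Y y) (fst p)"
    unfolding psh_push_at[OF y] by (rule Sup_hom[OF ob A])
  show "psh_push Q X Y f p \<bullet> y \<preceq> w \<longleftrightarrow> (\<forall>x\<in>carrier X. p \<bullet> x \<cdot> hm Y y (f x) \<preceq> w)"
    if "w \<in> hom_set Q (tp Y y) (fst p)"
    unfolding psh_push_at[OF y] Sup_le_iff[OF ob A that] by blast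
  show "u \<cdot> psh_push Q X Y f p \<bullet> y \<preceq> w \<longleftrightarrow> (\<forall>x\<in>carrier X. u \<cdot> (p \<bullet> x \<cdot> hm Y y (f x)) \<preceq> w)"
    if "u \<in> hom_set Q (fst p) s" "w \<in> hom_set Q (tp Y y) s"
    unfolding psh_push_at[OF y] Comp_Sup_le_iff[OF that(1) A that(2)] by blast
  show "psh_push Q X Y f p \<bullet> y \<cdot> u \<preceq> w \<longleftrightarrow> (\<forall>x\<in>carrier X. p \<bullet> x \<cdot> hm Y y (f x) \<cdot> u \<preceq> w)"
    if "u \<in> hom_set Q s (tp Y y)" "w \<in> hom_set Q s (fst p)"
    unfolding psh_push_at[OF y] Sup_Comp_le_iff[OF that(1) A that(2)] by blast
qed

lemma psh_push_upper:
  assumes f: "qfunctor Q X Y f" and p: "p \<in> carrier (PSh Q X)" and y: "y \<in> carrier Y"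
    and x: "x \<in> carrier X"
  shows "p \<bullet> x \<cdot> hm Y y (f x) \<preceq> psh_push Q X Y f p \<bullet> y"
  using psh_push_at_le_iff[OF f p y psh_push_hom[OF f p y]] le_refl[OF psh_push_hom[OF f p y]] x by blast

lemma
  assumes f: "qfunctor Q X Y f" and p: "p \<in> carrier (CoPSh Q X)" and y: "y \<in> carrier Y"
  shows copsh_push_hom: "copsh_push Q X Y f p \<star> y \<in> hom_set Q (fst p) (tp Y y)"
    and copsh_push_at_le_iff: "w \<in> hom_set Q (fst p) (tp Y y) \<Longrightarrow>
      copsh_push Q X Y f p \<star> y \<preceq> w \<longleftrightarrow> (\<forall>x\<in>carrier X. hm Y (f x) y \<cdot> p \<star> x \<preceq> w)"
    and copsh_push_at_Comp_le_iff: "u \<in> hom_set Q s (fst p) \<Longrightarrow> w \<in> hom_set Q s (tp Y y) \<Longrightarrow>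
      copsh_push Q X Y f p \<star> y \<cdot> u \<preceq> w \<longleftrightarrow> (\<forall>x\<in>carrier X. hm Y (f x) y \<cdot> p \<star> x \<cdot> u \<preceq> w)"
    and Comp_copsh_push_at_le_iff: "u \<in> hom_set Q (tp Y y) s \<Longrightarrow> w \<in> hom_set Q (fst p) s \<Longrightarrow>
      u \<cdot> copsh_push Q X Y f p \<star> y \<preceq> w \<longleftrightarrow> (\<forall>x\<in>carrier X. u \<cdot> (hm Y (f x) y \<cdot> p \<star> x) \<preceq> w)"
proof -
  note X = qfunctor_dom[OF f] and Y = qfunctor_cod[OF f]
  note ob = CoPSh_Obj[OF X p] qcat_tp[OF Y y]
  have A: "(\<lambda>x. hm Y (f x) y \<cdot> p \<star> x) ` carrier X \<subseteq> hom_set Q (fst p) (tp Y y)"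
    using Comp_hom[OF CoPSh_hom[OF X p] qfunctor_hom_from[OF f _ y]] by blast
  show "copsh_push Q X Y f p \<star> y \<in> hom_set Q (fst p) (tp Y y)"
    unfolding copsh_push_at[OF y] by (rule Sup_hom[OF ob A])
  show "copsh_push Q X Y f p \<star> y \<preceq> w \<longleftrightarrow> (\<forall>x\<in>carrier X. hm Y (f x) y \<cdot> p \<star> x \<preceq> w)"
    if "w \<in> hom_set Q (fst p) (tp Y y)"
    unfolding copsh_push_at[OF y] Sup_le_iff[OF ob A that] by blast
  show "copsh_push Q X Y f p \<star> y \<cdot> u \<preceq> w \<longleftrightarrow> (\<forall>x\<in>carrier X. hm Y (f x) y \<cdot> p \<star> x \<cdot> u \<preceq> w)"
    if "u \<in> hom_set Q s (fst p)" "w \<in> hom_set Q s (tp Y y)"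
    unfolding copsh_push_at[OF y] Sup_Comp_le_iff[OF that(1) A that(2)] by blast
  show "u \<cdot> copsh_push Q X Y f p \<star> y \<preceq> w \<longleftrightarrow> (\<forall>x\<in>carrier X. u \<cdot> (hm Y (f x) y \<cdot> p \<star> x) \<preceq> w)"
    if "u \<in> hom_set Q (tp Y y) s" "w \<in> hom_set Q (fst p) s"
    unfolding copsh_push_at[OF y] Comp_Sup_le_iff[OF that(1) A that(2)] by blast
qed

lemma copsh_push_upper:
  assumes f: "qfunctor Q X Y f" and p: "p \<in> carrier (CoPSh Q X)" and y: "y \<in> carrier Y"
    and x: "x \<in> carrier X"
  shows "hm Y (f x) y \<cdot> p \<star> x \<preceq> copsh_push Q X Y f p \<star> y"
  using copsh_push_at_le_iff[OF f p y copsh_push_hom[OF f p y]] le_refl[OF copsh_push_hom[OF f p y]] x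
  by blast

lemma carrier_psh_push:
  assumes f: "qfunctor Q X Y f" and p: "p \<in> carrier (PSh Q X)"
  shows "psh_push Q X Y f p \<in> carrier (PSh Q Y)"
proof -
  note X = qfunctor_dom[OF f] and Y = qfunctor_cod[OF f]
  have "snd (psh_push Q X Y f p) \<in> extensional (carrier Y)"
    by (cases p) (simp add: psh_push_def qrel_comp_def)
  moreover have "psh_push Q X Y f p \<bullet> y' \<cdot> hm Y y y' \<preceq> psh_push Q X Y f p \<bullet> y"
    if y: "y \<in> carrier Y" "y' \<in> carrier Y" for y y'
  proof -
    have "p \<bullet> x \<cdot> hm Y y' (f x) \<cdot> hm Y y y' \<preceq> psh_push Q X Y f p \<bullet> y" if x: "x \<in> carrier X" for x
    proof -
      note px = PSh_hom[OF X p x] and h = qcat_hm[OF Y y] and h' = qfunctor_hom_to[OF f x y(2)]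
        and h'' = qfunctor_hom_to[OF f x y(1)]
      have "p \<bullet> x \<cdot> (hm Y y' (f x) \<cdot> hm Y y y') \<preceq> psh_push Q X Y f p \<bullet> y"
        by (rule le_trans[OF Comp_mono_right[OF qcat_comp[OF Y y qfunctor_carrier[OF f x]]
                Comp_hom[OF h h'] h'' px] psh_push_upper[OF f p y(1) x]
              Comp_hom[OF Comp_hom[OF h h'] px] Comp_hom[OF h'' px] psh_push_hom[OF f p y(1)]])
      then show ?thesis using Comp_assoc[OF h h' px] by simp
    qed
    then show ?thesis
      using psh_push_at_Comp_le_iff[OF f p y(2) qcat_hm[OF Y y] psh_push_hom[OF f p y(1)]] by blast
  qed
  ultimately show ?thesis
    using psh_push_hom[OF f p] PSh_Obj[OF X p] by (simp add: carrier_PSh_iff[OF Y])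
qed

lemma carrier_copsh_push:
  assumes f: "qfunctor Q X Y f" and p: "p \<in> carrier (CoPSh Q X)"
  shows "copsh_push Q X Y f p \<in> carrier (CoPSh Q Y)"
proof -
  note X = qfunctor_dom[OF f] and Y = qfunctor_cod[OF f]
  have "snd (copsh_push Q X Y f p) () \<in> extensional (carrier Y)"
    by (cases p) (simp add: copsh_push_def qrel_comp_def one_qcat_def)
  moreover have "hm Y y y' \<cdot> copsh_push Q X Y f p \<star> y \<preceq> copsh_push Q X Y f p \<star> y'"
    if y: "y \<in> carrier Y" "y' \<in> carrier Y" for y y'
  proof -
    have "hm Y y y' \<cdot> (hm Y (f x) y \<cdot> p \<star> x) \<preceq> copsh_push Q X Y f p \<star> y'" if x: "x \<in> carrier X" for x
    proof -
      note px = CoPSh_hom[OF X p x] and h = qcat_hm[OF Y y] and h' = qfunctor_hom_from[OF f x y(1)]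
        and h'' = qfunctor_hom_from[OF f x y(2)]
      have "hm Y y y' \<cdot> hm Y (f x) y \<cdot> p \<star> x \<preceq> copsh_push Q X Y f p \<star> y'"
        by (rule le_trans[OF Comp_mono_left[OF qcat_comp[OF Y qfunctor_carrier[OF f x] y]
                px Comp_hom[OF h' h] h''] copsh_push_upper[OF f p y(2) x]
              Comp_hom[OF px Comp_hom[OF h' h]] Comp_hom[OF px h''] copsh_push_hom[OF f p y(2)]])
      then show ?thesis using Comp_assoc[OF px h' h] by simp
    qed
    then show ?thesis
      using Comp_copsh_push_at_le_iff[OF f p y(1) qcat_hm[OF Y y] copsh_push_hom[OF f p y(2)]] by blast
  qed
  ultimately show ?thesis
    using copsh_push_hom[OF f p] CoPSh_Obj[OF X p] by (simp add: carrier_CoPSh_iff[OF Y])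
qed

text \<open>A lower bound \<open>u\<close> of the left hom is characterised by
  \<open>u \<cdot> p(x) \<cdot> 1\<^sup>*(y, f x) \<preceq> q(y)\<close> for all \<open>x\<close> and \<open>y\<close>, since composition preserves the suprema in the
  direct image.  For fixed \<open>x\<close> the case \<open>y = f x\<close> implies all others, by the action on \<open>q\<close>, and it
  amounts to \<open>u \<cdot> p(x) \<preceq> q(f x)\<close>.\<close>

lemma psh_push_adjoint_pull:
  assumes f: "qfunctor Q X Y f" and p: "p \<in> carrier (PSh Q X)" and q: "q \<in> carrier (PSh Q Y)"
  shows "hm (PSh Q Y) (psh_push Q X Y f p) q = hm (PSh Q X) p (psh_pull Q X Y f q)"
proof (rule hom_eqI_below)
  note X = qfunctor_dom[OF f] and Y = qfunctor_cod[OF f] and fx = qfunctor_carrier[OF f]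
  note pp = carrier_psh_push[OF f p] and qq = carrier_psh_pull[OF f q]
  show "hm (PSh Q Y) (psh_push Q X Y f p) q \<in> hom_set Q (fst p) (fst q)"
    using hm_PSh_hom[OF Y pp q] by simp
  show "hm (PSh Q X) p (psh_pull Q X Y f q) \<in> hom_set Q (fst p) (fst q)"
    using hm_PSh_hom[OF X p qq] by simp
  fix u assume u: "u \<in> hom_set Q (fst p) (fst q)"
  have "u \<preceq> hm (PSh Q Y) (psh_push Q X Y f p) q \<longleftrightarrow>
      (\<forall>y\<in>carrier Y. u \<cdot> psh_push Q X Y f p \<bullet> y \<preceq> q \<bullet> y)"
    using le_hm_PSh_iff[OF Y pp q] u by simp
  also have "\<dots> \<longleftrightarrow> (\<forall>y\<in>carrier Y. \<forall>x\<in>carrier X. u \<cdot> (p \<bullet> x \<cdot> hm Y y (f x)) \<preceq> q \<bullet> y)"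
    using Comp_psh_push_at_le_iff[OF f p _ u PSh_hom[OF Y q]] by simp
  also have "\<dots> \<longleftrightarrow> (\<forall>x\<in>carrier X. u \<cdot> p \<bullet> x \<preceq> q \<bullet> f x)"
  proof safe
    fix x assume *: "\<forall>y\<in>carrier Y. \<forall>x\<in>carrier X. u \<cdot> (p \<bullet> x \<cdot> hm Y y (f x)) \<preceq> q \<bullet> y"
      and x: "x \<in> carrier X"
    have 1: "u \<cdot> (p \<bullet> x \<cdot> hm Y (f x) (f x)) \<preceq> q \<bullet> f x" by (rule bspec[OF bspec[OF * fx[OF x]] x])
    note px = PSh_hom[OF X p x] and i = qcat_Ident_hom[OF X x] and h = qfunctor_hom[OF f x x]
    have qx: "q \<bullet> f x \<in> hom_set Q (tp X x) (fst q)"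
      using PSh_hom[OF Y q fx[OF x]] qfunctor_tp[OF f x] by simp
    have "Ident Q (tp X x) \<preceq> hm Y (f x) (f x)"
      using qcat_Ident[OF Y fx[OF x]] qfunctor_tp[OF f x] by simp
    then have "u \<cdot> p \<bullet> x \<cdot> Ident Q (tp X x) \<preceq> u \<cdot> p \<bullet> x \<cdot> hm Y (f x) (f x)"
      by (rule Comp_mono_right[OF _ i h Comp_hom[OF px u]])
    then have "u \<cdot> p \<bullet> x \<preceq> u \<cdot> (p \<bullet> x \<cdot> hm Y (f x) (f x))"
      using Comp_Ident[OF Comp_hom[OF px u]] Comp_assoc[OF h px u] by simp
    then show "u \<cdot> p \<bullet> x \<preceq> q \<bullet> f x"
      by (rule le_trans[OF _ 1 Comp_hom[OF px u] Comp_hom[OF Comp_hom[OF h px] u] qx])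
  next
    fix y x assume *: "\<forall>x\<in>carrier X. u \<cdot> p \<bullet> x \<preceq> q \<bullet> f x"
      and x: "x \<in> carrier X" and y: "y \<in> carrier Y"
    have 1: "u \<cdot> p \<bullet> x \<preceq> q \<bullet> f x" by (rule bspec[OF * x])
    note px = PSh_hom[OF X p x] and h = qfunctor_hom_to[OF f x y]
    have qx: "q \<bullet> f x \<in> hom_set Q (tp X x) (fst q)"
      using PSh_hom[OF Y q fx[OF x]] qfunctor_tp[OF f x] by simp
    have "u \<cdot> p \<bullet> x \<cdot> hm Y y (f x) \<preceq> q \<bullet> y"
      by (rule le_trans[OF Comp_mono_left[OF 1 h Comp_hom[OF px u] qx] PSh_act[OF Y q y fx[OF x]]
            Comp_hom[OF h Comp_hom[OF px u]] Comp_hom[OF h qx] PSh_hom[OF Y q y]])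
    then show "u \<cdot> (p \<bullet> x \<cdot> hm Y y (f x)) \<preceq> q \<bullet> y" using Comp_assoc[OF h px u] by simp
  qed
  also have "\<dots> \<longleftrightarrow> u \<preceq> hm (PSh Q X) p (psh_pull Q X Y f q)"
    using le_hm_PSh_iff[OF X p qq] u psh_pull_at[OF f q] by simp
  finally show "u \<preceq> hm (PSh Q Y) (psh_push Q X Y f p) q \<longleftrightarrow>
      u \<preceq> hm (PSh Q X) p (psh_pull Q X Y f q)" .
qed

text \<open>The dual argument.  The order of copresheaves is opposite to the pointwise one, so the direct
  image is now the right adjoint.\<close>

lemma copsh_pull_adjoint_push:
  assumes f: "qfunctor Q X Y f" and p: "p \<in> carrier (CoPSh Q X)" and q: "q \<in> carrier (CoPSh Q Y)"
  shows "hm (CoPSh Q Y) q (copsh_push Q X Y f p) = hm (CoPSh Q X) (copsh_pull X f q) p"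
proof (rule hom_eqI_below)
  note X = qfunctor_dom[OF f] and Y = qfunctor_cod[OF f] and fx = qfunctor_carrier[OF f]
  note pp = carrier_copsh_push[OF f p] and qq = carrier_copsh_pull[OF f q]
  show "hm (CoPSh Q Y) q (copsh_push Q X Y f p) \<in> hom_set Q (fst q) (fst p)"
    using hm_CoPSh_hom[OF Y q pp] by simp
  show "hm (CoPSh Q X) (copsh_pull X f q) p \<in> hom_set Q (fst q) (fst p)"
    using hm_CoPSh_hom[OF X qq p] by simp
  fix u assume u: "u \<in> hom_set Q (fst q) (fst p)"
  have "u \<preceq> hm (CoPSh Q Y) q (copsh_push Q X Y f p) \<longleftrightarrow>
      (\<forall>y\<in>carrier Y. copsh_push Q X Y f p \<star> y \<cdot> u \<preceq> q \<star> y)"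
    using le_hm_CoPSh_iff[OF Y q pp] u by simp
  also have "\<dots> \<longleftrightarrow> (\<forall>y\<in>carrier Y. \<forall>x\<in>carrier X. hm Y (f x) y \<cdot> p \<star> x \<cdot> u \<preceq> q \<star> y)"
    using copsh_push_at_Comp_le_iff[OF f p _ u CoPSh_hom[OF Y q]] by simp
  also have "\<dots> \<longleftrightarrow> (\<forall>x\<in>carrier X. p \<star> x \<cdot> u \<preceq> q \<star> f x)"
  proof safe
    fix x assume *: "\<forall>y\<in>carrier Y. \<forall>x\<in>carrier X. hm Y (f x) y \<cdot> p \<star> x \<cdot> u \<preceq> q \<star> y"
      and x: "x \<in> carrier X"
    have 1: "hm Y (f x) (f x) \<cdot> p \<star> x \<cdot> u \<preceq> q \<star> f x" by (rule bspec[OF bspec[OF * fx[OF x]] x])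
    note px = CoPSh_hom[OF X p x] and i = qcat_Ident_hom[OF X x] and h = qfunctor_hom[OF f x x]
    have qx: "q \<star> f x \<in> hom_set Q (fst q) (tp X x)"
      using CoPSh_hom[OF Y q fx[OF x]] qfunctor_tp[OF f x] by simp
    have "Ident Q (tp X x) \<preceq> hm Y (f x) (f x)"
      using qcat_Ident[OF Y fx[OF x]] qfunctor_tp[OF f x] by simp
    then have "Ident Q (tp X x) \<cdot> (p \<star> x \<cdot> u) \<preceq> hm Y (f x) (f x) \<cdot> (p \<star> x \<cdot> u)"
      by (rule Comp_mono_left[OF _ Comp_hom[OF u px] i h])
    then have "p \<star> x \<cdot> u \<preceq> hm Y (f x) (f x) \<cdot> p \<star> x \<cdot> u"
      using Ident_Comp[OF Comp_hom[OF u px]] Comp_assoc[OF u px h] by simp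
    then show "p \<star> x \<cdot> u \<preceq> q \<star> f x"
      by (rule le_trans[OF _ 1 Comp_hom[OF u px] Comp_hom[OF u Comp_hom[OF px h]] qx])
  next
    fix y x assume *: "\<forall>x\<in>carrier X. p \<star> x \<cdot> u \<preceq> q \<star> f x"
      and x: "x \<in> carrier X" and y: "y \<in> carrier Y"
    have 1: "p \<star> x \<cdot> u \<preceq> q \<star> f x" by (rule bspec[OF * x])
    note px = CoPSh_hom[OF X p x] and h = qfunctor_hom_from[OF f x y]
    have qx: "q \<star> f x \<in> hom_set Q (fst q) (tp X x)"
      using CoPSh_hom[OF Y q fx[OF x]] qfunctor_tp[OF f x] by simp
    have "hm Y (f x) y \<cdot> (p \<star> x \<cdot> u) \<preceq> q \<star> y"
      by (rule le_trans[OF Comp_mono_right[OF 1 Comp_hom[OF u px] qx h] CoPSh_act[OF Y q fx[OF x] y]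
            Comp_hom[OF Comp_hom[OF u px] h] Comp_hom[OF qx h] CoPSh_hom[OF Y q y]])
    then show "hm Y (f x) y \<cdot> p \<star> x \<cdot> u \<preceq> q \<star> y" using Comp_assoc[OF u px h] by simp
  qed
  also have "\<dots> \<longleftrightarrow> u \<preceq> hm (CoPSh Q X) (copsh_pull X f q) p"
    using le_hm_CoPSh_iff[OF X qq p] u by simp
  finally show "u \<preceq> hm (CoPSh Q Y) q (copsh_push Q X Y f p) \<longleftrightarrow>
      u \<preceq> hm (CoPSh Q X) (copsh_pull X f q) p" .
qed

end

section \<open>The presheaf constructions as 2-functors\<close>

context quantaloid
begin

lemma qcat_le_psh_push_iff:
  assumes f: "qfunctor Q X Y f" and p: "p \<in> carrier (PSh Q X)" and q: "q \<in> carrier (PSh Q Y)"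
  shows "qcat_le Q (PSh Q Y) (psh_push Q X Y f p) q \<longleftrightarrow> qcat_le Q (PSh Q X) p (psh_pull Q X Y f q)"
  using psh_push_adjoint_pull[OF f p q] carrier_psh_push[OF f p] carrier_psh_pull[OF f q] p q
  by (simp add: qcat_le_def)

lemma qcat_le_copsh_push_iff:
  assumes f: "qfunctor Q X Y f" and p: "p \<in> carrier (CoPSh Q X)" and q: "q \<in> carrier (CoPSh Q Y)"
  shows "qcat_le Q (CoPSh Q Y) q (copsh_push Q X Y f p) \<longleftrightarrow>
    qcat_le Q (CoPSh Q X) (copsh_pull X f q) p"
  using copsh_pull_adjoint_push[OF f p q] carrier_copsh_push[OF f p] carrier_copsh_pull[OF f q] p q
  by (simp add: qcat_le_def)

lemma le_psh_pull_push:
  assumes f: "qfunctor Q X Y f" and p: "p \<in> carrier (PSh Q X)"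
  shows "qcat_le Q (PSh Q X) p (psh_pull Q X Y f (psh_push Q X Y f p))"
  using qcat_le_psh_push_iff[OF f p carrier_psh_push[OF f p]]
    qcat_le_refl[OF is_qcat_PSh[OF qfunctor_cod[OF f]] carrier_psh_push[OF f p]] by blast

lemma copsh_pull_push_le:
  assumes f: "qfunctor Q X Y f" and p: "p \<in> carrier (CoPSh Q X)"
  shows "qcat_le Q (CoPSh Q X) (copsh_pull X f (copsh_push Q X Y f p)) p"
  using qcat_le_copsh_push_iff[OF f p carrier_copsh_push[OF f p]]
    qcat_le_refl[OF is_qcat_CoPSh[OF qfunctor_cod[OF f]] carrier_copsh_push[OF f p]] by blast

lemma qfunctor_psh_pull:
  assumes f: "qfunctor Q X Y f"
  shows "qfunctor Q (PSh Q Y) (PSh Q X) (psh_pull Q X Y f)"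
proof -
  note X = qfunctor_dom[OF f] and Y = qfunctor_cod[OF f] and fc = carrier_psh_pull[OF f]
  have "hm (PSh Q Y) q q' \<preceq> hm (PSh Q X) (psh_pull Q X Y f q) (psh_pull Q X Y f q')"
    if q: "q \<in> carrier (PSh Q Y)" "q' \<in> carrier (PSh Q Y)" for q q'
    using le_hm_PSh_iff[OF X fc[OF q(1)] fc[OF q(2)]] hm_PSh_hom[OF Y q]
      hm_PSh_at[OF Y q qfunctor_carrier[OF f]] psh_pull_at[OF f q(1)] psh_pull_at[OF f q(2)] by simp
  then show ?thesis
    using is_qcat_PSh[OF X] is_qcat_PSh[OF Y] fc by (simp add: qfunctor_def)
qed

lemma qfunctor_psh_push:
  assumes f: "qfunctor Q X Y f"
  shows "qfunctor Q (PSh Q X) (PSh Q Y) (psh_push Q X Y f)"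
proof -
  note X = qfunctor_dom[OF f] and Y = qfunctor_cod[OF f] and fc = carrier_psh_push[OF f]
  have "hm (PSh Q X) p p' \<preceq> hm (PSh Q Y) (psh_push Q X Y f p) (psh_push Q X Y f p')"
    if p: "p \<in> carrier (PSh Q X)" "p' \<in> carrier (PSh Q X)" for p p'
    using qcat_le_hm_mono(1)[OF is_qcat_PSh[OF X] le_psh_pull_push[OF f p(2)] p(1)]
    unfolding psh_push_adjoint_pull[OF f p(1) fc[OF p(2)]] .
  then show ?thesis
    using is_qcat_PSh[OF X] is_qcat_PSh[OF Y] fc by (simp add: qfunctor_def)
qed

lemma qfunctor_copsh_push:
  assumes f: "qfunctor Q X Y f"
  shows "qfunctor Q (CoPSh Q X) (CoPSh Q Y) (copsh_push Q X Y f)"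
proof -
  note X = qfunctor_dom[OF f] and Y = qfunctor_cod[OF f] and fc = carrier_copsh_push[OF f]
  have "hm (CoPSh Q X) p p' \<preceq> hm (CoPSh Q Y) (copsh_push Q X Y f p) (copsh_push Q X Y f p')"
    if p: "p \<in> carrier (CoPSh Q X)" "p' \<in> carrier (CoPSh Q X)" for p p'
    using qcat_le_hm_mono(2)[OF is_qcat_CoPSh[OF X] copsh_pull_push_le[OF f p(1)] p(2)]
    unfolding copsh_pull_adjoint_push[OF f p(2) fc[OF p(1)]] .
  then show ?thesis
    using is_qcat_CoPSh[OF X] is_qcat_CoPSh[OF Y] fc by (simp add: qfunctor_def)
qed

text \<open>Inverse images compose strictly, being precompositions, and each side is left adjoint to the
  composite inverse image.\<close>

lemma psh_push_comp:
  assumes f: "qfunctor Q X Y f" and g: "qfunctor Q Y Z g" and p: "p \<in> carrier (PSh Q X)"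
  shows "psh_push Q X Z (g \<circ> f) p = psh_push Q Y Z g (psh_push Q X Y f p)" (is "?A = ?B")
proof -
  note gf = qfunctor_comp[OF f g] and fp = carrier_psh_push[OF f p] and gc = carrier_psh_pull[OF g]
  have pull: "psh_pull Q X Z (g \<circ> f) q = psh_pull Q X Y f (psh_pull Q Y Z g q)"
    if q: "q \<in> carrier (PSh Q Z)" for q
    by (rule PSh_eqI[OF qfunctor_dom[OF f] carrier_psh_pull[OF gf q] carrier_psh_pull[OF f gc[OF q]]])
      (simp_all add: psh_pull_at[OF gf q] psh_pull_at[OF f gc[OF q]] psh_pull_at[OF g q]
        qfunctor_carrier[OF f])
  have iff: "qcat_le Q (PSh Q Z) ?A q \<longleftrightarrow> qcat_le Q (PSh Q Z) ?B q"
    if q: "q \<in> carrier (PSh Q Z)" for q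
    using qcat_le_psh_push_iff[OF gf p q] qcat_le_psh_push_iff[OF g fp q]
      qcat_le_psh_push_iff[OF f p gc[OF q]] pull[OF q] by simp
  note A = carrier_psh_push[OF gf p] and B = carrier_psh_push[OF g fp]
  note Z = qfunctor_cod[OF g]
  note refl = qcat_le_refl[OF is_qcat_PSh[OF Z]]
  show ?thesis
    by (rule PSh_antisym[OF Z]) (use iff[OF A] iff[OF B] refl[OF A] refl[OF B] in blast)+
qed

lemma copsh_push_comp:
  assumes f: "qfunctor Q X Y f" and g: "qfunctor Q Y Z g" and p: "p \<in> carrier (CoPSh Q X)"
  shows "copsh_push Q X Z (g \<circ> f) p = copsh_push Q Y Z g (copsh_push Q X Y f p)" (is "?A = ?B")
proof -
  note gf = qfunctor_comp[OF f g] and fp = carrier_copsh_push[OF f p] and gc = carrier_copsh_pull[OF g]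
  have pull: "copsh_pull X (g \<circ> f) q = copsh_pull X f (copsh_pull Y g q)"
    if q: "q \<in> carrier (CoPSh Q Z)" for q
    by (rule CoPSh_eqI[OF qfunctor_dom[OF f] carrier_copsh_pull[OF gf q]
          carrier_copsh_pull[OF f gc[OF q]]]) (simp_all add: qfunctor_carrier[OF f])
  have iff: "qcat_le Q (CoPSh Q Z) q ?A \<longleftrightarrow> qcat_le Q (CoPSh Q Z) q ?B"
    if q: "q \<in> carrier (CoPSh Q Z)" for q
    using qcat_le_copsh_push_iff[OF gf p q] qcat_le_copsh_push_iff[OF g fp q]
      qcat_le_copsh_push_iff[OF f p gc[OF q]] pull[OF q] by simp
  note A = carrier_copsh_push[OF gf p] and B = carrier_copsh_push[OF g fp]
  note Z = qfunctor_cod[OF g]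
  note refl = qcat_le_refl[OF is_qcat_CoPSh[OF Z]]
  show ?thesis
    by (rule CoPSh_antisym[OF Z]) (use iff[OF A] iff[OF B] refl[OF A] refl[OF B] in blast)+
qed

lemma qfunctor_id: "is_qcat Q X \<Longrightarrow> qfunctor Q X X (\<lambda>x. x)"
  by (simp add: qfunctorI_fully_faithful fully_faithful_def)

text \<open>The unit of the adjunction is invertible: at \<open>f x\<close> the direct image is the supremum of
  \<open>p(x') \<cdot> 1\<^sup>*(f x, f x') = p(x') \<cdot> 1\<^sup>*(x, x')\<close>, which the action on \<open>p\<close> bounds by \<open>p(x)\<close>.\<close>

lemma psh_pull_push_fully_faithful:
  assumes f: "qfunctor Q X Y f" and ff: "fully_faithful X Y f" and p: "p \<in> carrier (PSh Q X)"
  shows "psh_pull Q X Y f (psh_push Q X Y f p) = p"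
proof (rule PSh_antisym[OF qfunctor_dom[OF f] _ le_psh_pull_push[OF f p]])
  note X = qfunctor_dom[OF f] and fp = carrier_psh_push[OF f p]
  have "psh_push Q X Y f p \<bullet> f x \<preceq> p \<bullet> x" if x: "x \<in> carrier X" for x
    using psh_push_at_le_iff[OF f p qfunctor_carrier[OF f x], of "p \<bullet> x"] PSh_hom[OF X p x]
      PSh_act[OF X p x] qfunctor_tp[OF f x] ff x by (simp add: fully_faithful_def)
  then show "qcat_le Q (PSh Q X) (psh_pull Q X Y f (psh_push Q X Y f p)) p"
    using carrier_psh_pull[OF f fp] psh_pull_at[OF f fp] p by (simp add: qcat_le_PSh_iff[OF X])
qed

lemma copsh_pull_push_fully_faithful:
  assumes f: "qfunctor Q X Y f" and ff: "fully_faithful X Y f" and p: "p \<in> carrier (CoPSh Q X)"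
  shows "copsh_pull X f (copsh_push Q X Y f p) = p"
proof (rule CoPSh_antisym[OF qfunctor_dom[OF f] copsh_pull_push_le[OF f p]])
  note X = qfunctor_dom[OF f] and fp = carrier_copsh_push[OF f p]
  have "copsh_push Q X Y f p \<star> f x \<preceq> p \<star> x" if x: "x \<in> carrier X" for x
    using copsh_push_at_le_iff[OF f p qfunctor_carrier[OF f x], of "p \<star> x"] CoPSh_hom[OF X p x]
      CoPSh_act[OF X p _ x] qfunctor_tp[OF f x] ff x by (simp add: fully_faithful_def)
  then show "qcat_le Q (CoPSh Q X) p (copsh_pull X f (copsh_push Q X Y f p))"
    using carrier_copsh_pull[OF f fp] p by (simp add: qcat_le_CoPSh_iff[OF X])
qed

text \<open>Transpose one direct image across the adjunction and cancel the other by the previous lemma.\<close>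

lemma fully_faithful_copsh_push:
  assumes f: "qfunctor Q X Y f" and ff: "fully_faithful X Y f"
  shows "fully_faithful (CoPSh Q X) (CoPSh Q Y) (copsh_push Q X Y f)"
  using copsh_pull_adjoint_push[OF f] carrier_copsh_push[OF f] copsh_pull_push_fully_faithful[OF f ff]
  by (simp add: fully_faithful_def)

lemma psh_push_id:
  assumes X: "is_qcat Q X" and p: "p \<in> carrier (PSh Q X)"
  shows "psh_push Q X X (\<lambda>x. x) p = p"
proof -
  note i = qfunctor_id[OF X]
  note ip = carrier_psh_push[OF i p]
  have "psh_pull Q X X (\<lambda>x. x) (psh_push Q X X (\<lambda>x. x) p) = psh_push Q X X (\<lambda>x. x) p"
    by (rule PSh_eqI[OF X carrier_psh_pull[OF i ip] ip]) (simp_all add: psh_pull_at[OF i ip])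
  then show ?thesis
    using psh_pull_push_fully_faithful[OF i _ p] by (simp add: fully_faithful_def)
qed

lemma copsh_push_id:
  assumes X: "is_qcat Q X" and p: "p \<in> carrier (CoPSh Q X)"
  shows "copsh_push Q X X (\<lambda>x. x) p = p"
proof -
  note i = qfunctor_id[OF X]
  note ip = carrier_copsh_push[OF i p]
  have "copsh_pull X (\<lambda>x. x) (copsh_push Q X X (\<lambda>x. x) p) = copsh_push Q X X (\<lambda>x. x) p"
    by (rule CoPSh_eqI[OF X carrier_copsh_pull[OF i ip] ip]) simp_all
  then show ?thesis
    using copsh_pull_push_fully_faithful[OF i _ p] by (simp add: fully_faithful_def)
qed

text \<open>Inverse image is antitone in the functor because presheaves are; its left adjoint is therefore
  monotone.\<close>

lemma psh_push_mono:
  assumes f: "qfunctor Q X Y f" and g: "qfunctor Q X Y g" and le: "qfun_le Q X Y f g"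
    and p: "p \<in> carrier (PSh Q X)"
  shows "qcat_le Q (PSh Q Y) (psh_push Q X Y f p) (psh_push Q X Y g p)"
proof -
  note X = qfunctor_dom[OF f] and Y = qfunctor_cod[OF f] and gp = carrier_psh_push[OF g p]
  have "qcat_le Q (PSh Q X) (psh_pull Q X Y g (psh_push Q X Y g p))
     (psh_pull Q X Y f (psh_push Q X Y g p))"
    using carrier_psh_pull[OF f gp] carrier_psh_pull[OF g gp] psh_pull_at[OF f gp] psh_pull_at[OF g gp]
      PSh_antitone[OF Y gp] le by (simp add: qcat_le_PSh_iff[OF X] qfun_le_def)
  then have "qcat_le Q (PSh Q X) p (psh_pull Q X Y f (psh_push Q X Y g p))"
    by (rule qcat_le_trans[OF is_qcat_PSh[OF X] le_psh_pull_push[OF g p]])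
  then show ?thesis using qcat_le_psh_push_iff[OF f p gp] by blast
qed

lemma copsh_push_mono:
  assumes f: "qfunctor Q X Y f" and g: "qfunctor Q X Y g" and le: "qfun_le Q X Y f g"
    and p: "p \<in> carrier (CoPSh Q X)"
  shows "qcat_le Q (CoPSh Q Y) (copsh_push Q X Y f p) (copsh_push Q X Y g p)"
proof -
  note X = qfunctor_dom[OF f] and Y = qfunctor_cod[OF f] and fp = carrier_copsh_push[OF f p]
  have "qcat_le Q (CoPSh Q X) (copsh_pull X g (copsh_push Q X Y f p))
     (copsh_pull X f (copsh_push Q X Y f p))"
    using carrier_copsh_pull[OF f fp] carrier_copsh_pull[OF g fp]
      CoPSh_monotone[OF Y fp] le by (simp add: qcat_le_CoPSh_iff[OF X] qfun_le_def)
  then have "qcat_le Q (CoPSh Q X) (copsh_pull X g (copsh_push Q X Y f p)) p"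
    by (rule qcat_le_trans[OF is_qcat_CoPSh[OF X] _ copsh_pull_push_le[OF f p]])
  then show ?thesis using qcat_le_copsh_push_iff[OF g p fp] by blast
qed

lemma yoneda_le_iff:
  assumes X: "is_qcat Q X" and x: "x \<in> carrier X" and p: "p \<in> carrier (PSh Q X)"
  shows "qcat_le Q (PSh Q X) (yoneda X x) p \<longleftrightarrow> fst p = tp X x \<and> Ident Q (tp X x) \<preceq> p \<bullet> x"
  using Yoneda[OF X x p] carrier_yoneda[OF X x] p by (auto simp: qcat_le_def)

lemma le_coyoneda_iff:
  assumes X: "is_qcat Q X" and x: "x \<in> carrier X" and p: "p \<in> carrier (CoPSh Q X)"
  shows "qcat_le Q (CoPSh Q X) p (coyoneda X x) \<longleftrightarrow> fst p = tp X x \<and> Ident Q (tp X x) \<preceq> p \<star> x"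
  using coYoneda[OF X x p] carrier_coyoneda[OF X x] p by (auto simp: qcat_le_def)

text \<open>Both sides have the same upper bounds \<open>q\<close>: by the Yoneda lemma the condition is in either case
  that \<open>q(f x)\<close> lies above the identity.\<close>

lemma psh_push_yoneda:
  assumes f: "qfunctor Q X Y f" and x: "x \<in> carrier X"
  shows "psh_push Q X Y f (yoneda X x) = yoneda Y (f x)" (is "?A = ?B")
proof -
  note X = qfunctor_dom[OF f] and Y = qfunctor_cod[OF f] and fx = qfunctor_carrier[OF f x]
  have iff: "qcat_le Q (PSh Q Y) ?A q \<longleftrightarrow> qcat_le Q (PSh Q Y) ?B q"
    if q: "q \<in> carrier (PSh Q Y)" for q
    using qcat_le_psh_push_iff[OF f carrier_yoneda[OF X x] q]
      yoneda_le_iff[OF X x carrier_psh_pull[OF f q]] yoneda_le_iff[OF Y fx q]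
      psh_pull_at[OF f q x] qfunctor_tp[OF f x] by simp
  note A = carrier_psh_push[OF f carrier_yoneda[OF X x]] and B = carrier_yoneda[OF Y fx]
  note refl = qcat_le_refl[OF is_qcat_PSh[OF Y]]
  show ?thesis
    by (rule PSh_antisym[OF Y]) (use iff[OF A] iff[OF B] refl[OF A] refl[OF B] in blast)+
qed

lemma copsh_push_coyoneda:
  assumes f: "qfunctor Q X Y f" and x: "x \<in> carrier X"
  shows "copsh_push Q X Y f (coyoneda X x) = coyoneda Y (f x)" (is "?A = ?B")
proof -
  note X = qfunctor_dom[OF f] and Y = qfunctor_cod[OF f] and fx = qfunctor_carrier[OF f x]
  have iff: "qcat_le Q (CoPSh Q Y) q ?A \<longleftrightarrow> qcat_le Q (CoPSh Q Y) q ?B"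
    if q: "q \<in> carrier (CoPSh Q Y)" for q
    using qcat_le_copsh_push_iff[OF f carrier_coyoneda[OF X x] q]
      le_coyoneda_iff[OF X x carrier_copsh_pull[OF f q]] le_coyoneda_iff[OF Y fx q]
      x qfunctor_tp[OF f x] by simp
  note A = carrier_copsh_push[OF f carrier_coyoneda[OF X x]] and B = carrier_coyoneda[OF Y fx]
  note refl = qcat_le_refl[OF is_qcat_CoPSh[OF Y]]
  show ?thesis
    by (rule CoPSh_antisym[OF Y]) (use iff[OF A] iff[OF B] refl[OF A] refl[OF B] in blast)+
qed

lemma qfunctor_psh_mult: "is_qcat Q X \<Longrightarrow> qfunctor Q (PSh Q (PSh Q X)) (PSh Q X) (psh_mult Q X)"
  unfolding psh_mult_def by (rule qfunctor_psh_pull[OF qfunctor_yoneda])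

lemma psh_mult_yoneda:
  assumes X: "is_qcat Q X" and p: "p \<in> carrier (PSh Q X)"
  shows "psh_mult Q X (yoneda (PSh Q X) p) = p"
proof (rule PSh_eqI[OF X _ p])
  note y = carrier_yoneda[OF is_qcat_PSh[OF X] p]
  show "psh_mult Q X (yoneda (PSh Q X) p) \<in> carrier (PSh Q X)"
    by (rule qfunctor_carrier[OF qfunctor_psh_mult[OF X] y])
  show "fst (psh_mult Q X (yoneda (PSh Q X) p)) = fst p" by (simp add: psh_mult_def)
  show "psh_mult Q X (yoneda (PSh Q X) p) \<bullet> x = p \<bullet> x" if x: "x \<in> carrier X" for x
    using psh_pull_at[OF qfunctor_yoneda[OF X] y x] Yoneda[OF X x p] carrier_yoneda[OF X x]
    by (simp add: psh_mult_def)
qed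

end

section \<open>The double presheaf 2-monad\<close>

context quantaloid
begin

lemma is_qcat_DPSh: "is_qcat Q X \<Longrightarrow> is_qcat Q (DPSh Q X)"
  by (simp add: DPSh_def is_qcat_PSh is_qcat_CoPSh)

lemma qfunctor_dpsh_map:
  "qfunctor Q X Y f \<Longrightarrow> qfunctor Q (DPSh Q X) (DPSh Q Y) (dpsh_map Q X Y f)"
  unfolding DPSh_def dpsh_map_def by (rule qfunctor_psh_push[OF qfunctor_copsh_push])

lemma dpsh_map_cong:
  "(\<And>x. x \<in> carrier X \<Longrightarrow> f x = g x) \<Longrightarrow> dpsh_map Q X Y f = dpsh_map Q X Y g"
  unfolding dpsh_map_def by (simp cong: copsh_push_cong)

lemma dpsh_map_comp:
  assumes f: "qfunctor Q X Y f" and g: "qfunctor Q Y Z g" and p: "p \<in> carrier (DPSh Q X)"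
  shows "dpsh_map Q X Z (g \<circ> f) p = dpsh_map Q Y Z g (dpsh_map Q X Y f p)"
proof -
  have "psh_push Q (CoPSh Q X) (CoPSh Q Z) (copsh_push Q X Z (g \<circ> f)) =
    psh_push Q (CoPSh Q X) (CoPSh Q Z) (copsh_push Q Y Z g \<circ> copsh_push Q X Y f)"
    by (rule psh_push_cong) (simp add: copsh_push_comp[OF f g])
  then show ?thesis
    unfolding dpsh_map_def
    using psh_push_comp[OF qfunctor_copsh_push[OF f] qfunctor_copsh_push[OF g]] p
    by (simp add: DPSh_def)
qed

lemma dpsh_map_id:
  assumes X: "is_qcat Q X" and p: "p \<in> carrier (DPSh Q X)"
  shows "dpsh_map Q X X (\<lambda>x. x) p = p"
proof -
  have "psh_push Q (CoPSh Q X) (CoPSh Q X) (copsh_push Q X X (\<lambda>x. x)) =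
    psh_push Q (CoPSh Q X) (CoPSh Q X) (\<lambda>x. x)"
    by (rule psh_push_cong) (simp add: copsh_push_id[OF X])
  then show ?thesis
    using psh_push_id[OF is_qcat_CoPSh[OF X]] p by (simp add: dpsh_map_def DPSh_def)
qed

lemma dpsh_map_mono:
  assumes f: "qfunctor Q X Y f" and g: "qfunctor Q X Y g" and le: "qfun_le Q X Y f g"
    and p: "p \<in> carrier (DPSh Q X)"
  shows "qcat_le Q (DPSh Q Y) (dpsh_map Q X Y f p) (dpsh_map Q X Y g p)"
proof -
  have "qfun_le Q (CoPSh Q X) (CoPSh Q Y) (copsh_push Q X Y f) (copsh_push Q X Y g)"
    using copsh_push_mono[OF f g le] by (simp add: qfun_le_def)
  then show ?thesis
    using psh_push_mono[OF qfunctor_copsh_push[OF f] qfunctor_copsh_push[OF g]] p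
    unfolding dpsh_map_def DPSh_def by blast
qed

lemma qfunctor_dpsh_unit: "is_qcat Q X \<Longrightarrow> qfunctor Q X (DPSh Q X) (dpsh_unit Q X)"
  unfolding dpsh_unit_def DPSh_def
  by (rule qfunctor_comp[OF qfunctor_coyoneda qfunctor_yoneda[OF is_qcat_CoPSh]])

lemma dpsh_map_unit:
  assumes f: "qfunctor Q X Y f" and x: "x \<in> carrier X"
  shows "dpsh_map Q X Y f (dpsh_unit Q X x) = dpsh_unit Q Y (f x)"
  using psh_push_yoneda[OF qfunctor_copsh_push[OF f] carrier_coyoneda[OF qfunctor_dom[OF f] x]]
    copsh_push_coyoneda[OF f x] by (simp add: dpsh_map_def dpsh_unit_def)

text \<open>The multiplication at \<open>X\<close> is the inverse image along this functor \<open>P\<^sup>\<dagger>X \<rightarrow> P\<^sup>\<dagger>D X\<close>, whence its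
  lax naturality can be read off from the strict naturality of the functor.\<close>

definition dpsh_mult_index :: "('a, 'o, 'm) qcat \<Rightarrow> ('a, 'o, 'm) copsh \<Rightarrow> (('a, 'o, 'm) dpsh, 'o, 'm) copsh"
  where "dpsh_mult_index X =
    copsh_push Q (CoPSh Q X) (DPSh Q X) (yoneda (CoPSh Q X)) \<circ> coyoneda (CoPSh Q X)"

lemma dpsh_mult_eq: "dpsh_mult Q X = psh_pull Q (CoPSh Q X) (CoPSh Q (DPSh Q X)) (dpsh_mult_index X)"
  by (simp add: dpsh_mult_def dpsh_mult_index_def)

lemma qfunctor_dpsh_mult_index:
  "is_qcat Q X \<Longrightarrow> qfunctor Q (CoPSh Q X) (CoPSh Q (DPSh Q X)) (dpsh_mult_index X)"
  unfolding dpsh_mult_index_def DPSh_def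
  by (intro qfunctor_comp[OF qfunctor_coyoneda qfunctor_copsh_push[OF qfunctor_yoneda]] is_qcat_CoPSh)

lemma qfunctor_dpsh_mult:
  assumes X: "is_qcat Q X"
  shows "qfunctor Q (DPSh Q (DPSh Q X)) (DPSh Q X) (dpsh_mult Q X)"
  using qfunctor_psh_pull[OF qfunctor_dpsh_mult_index[OF X]] by (simp add: dpsh_mult_eq DPSh_def)

text \<open>Direct images of copresheaves preserve corepresentables and compose, so this reduces to the
  naturality of the Yoneda embedding of \<open>P\<^sup>\<dagger>X\<close>.\<close>

lemma dpsh_mult_index_natural:
  assumes f: "qfunctor Q X Y f" and t: "t \<in> carrier (CoPSh Q X)"
  shows "copsh_push Q (DPSh Q X) (DPSh Q Y) (dpsh_map Q X Y f) (dpsh_mult_index X t) =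
    dpsh_mult_index Y (copsh_push Q X Y f t)"
proof -
  let ?F = "copsh_push Q X Y f"
  let ?X = "CoPSh Q X" and ?Y = "CoPSh Q Y"
  note F = qfunctor_copsh_push[OF f] and Ff = qfunctor_dpsh_map[OF f]
  note X = is_qcat_CoPSh[OF qfunctor_dom[OF f]] and Y = is_qcat_CoPSh[OF qfunctor_cod[OF f]]
  have yX: "qfunctor Q ?X (DPSh Q X) (yoneda ?X)" and yY: "qfunctor Q ?Y (DPSh Q Y) (yoneda ?Y)"
    using qfunctor_yoneda[OF X] qfunctor_yoneda[OF Y] by (simp_all add: DPSh_def)
  note ct = carrier_coyoneda[OF X t]
  have "copsh_push Q (DPSh Q X) (DPSh Q Y) (dpsh_map Q X Y f) (dpsh_mult_index X t) =
      copsh_push Q ?X (DPSh Q Y) (dpsh_map Q X Y f \<circ> yoneda ?X) (coyoneda ?X t)"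
    using copsh_push_comp[OF yX Ff ct] by (simp add: dpsh_mult_index_def)
  also have "copsh_push Q ?X (DPSh Q Y) (dpsh_map Q X Y f \<circ> yoneda ?X) =
      copsh_push Q ?X (DPSh Q Y) (yoneda ?Y \<circ> ?F)"
    by (rule copsh_push_cong) (simp add: dpsh_map_def psh_push_yoneda[OF F])
  also have "\<dots> (coyoneda ?X t) = copsh_push Q ?Y (DPSh Q Y) (yoneda ?Y) (coyoneda ?Y (?F t))"
    using copsh_push_comp[OF F yY ct] copsh_push_coyoneda[OF F t] by simp
  finally show ?thesis by (simp add: dpsh_mult_index_def)
qed

text \<open>Transposed and evaluated at a copresheaf \<open>t\<close>, the inequality is the unit of the
  adjunction for the direct image of presheaves along the direct image of copresheaves along \<open>D f\<close>,
  at the point \<open>dpsh_mult_index X t\<close>.\<close>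

lemma dpsh_mult_lax_natural:
  assumes f: "qfunctor Q X Y f" and p: "p \<in> carrier (DPSh Q (DPSh Q X))"
  shows "qcat_le Q (DPSh Q Y) (dpsh_map Q X Y f (dpsh_mult Q X p))
    (dpsh_mult Q Y (dpsh_map Q (DPSh Q X) (DPSh Q Y) (dpsh_map Q X Y f) p))"
proof -
  let ?F = "copsh_push Q X Y f"
  let ?G = "copsh_push Q (DPSh Q X) (DPSh Q Y) (dpsh_map Q X Y f)"
  let ?p = "psh_push Q (CoPSh Q (DPSh Q X)) (CoPSh Q (DPSh Q Y)) ?G p"
  note X = qfunctor_dom[OF f] and Y = qfunctor_cod[OF f]
  note F = qfunctor_copsh_push[OF f] and G = qfunctor_copsh_push[OF qfunctor_dpsh_map[OF f]]
  note kX = qfunctor_dpsh_mult_index[OF X] and kY = qfunctor_dpsh_mult_index[OF Y]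
  have p': "p \<in> carrier (PSh Q (CoPSh Q (DPSh Q X)))" using p by (simp add: DPSh_def)
  note Gp = carrier_psh_push[OF G p']
  note mp = carrier_psh_pull[OF kX p'] and mGp = carrier_psh_pull[OF kY Gp]
  have "dpsh_mult Q X p \<bullet> t \<preceq> psh_pull Q (CoPSh Q X) (CoPSh Q Y) ?F (dpsh_mult Q Y ?p) \<bullet> t"
    if t: "t \<in> carrier (CoPSh Q X)" for t
  proof -
    have k: "dpsh_mult_index X t \<in> carrier (CoPSh Q (DPSh Q X))" by (rule qfunctor_carrier[OF kX t])
    have "p \<bullet> dpsh_mult_index X t \<preceq> ?p \<bullet> ?G (dpsh_mult_index X t)"
      using le_psh_pull_push[OF G p'] k psh_pull_at[OF G Gp k]
      by (auto simp: qcat_le_PSh_iff[OF is_qcat_CoPSh[OF is_qcat_DPSh[OF X]]])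
    then show ?thesis
      unfolding dpsh_mult_eq psh_pull_at[OF F mGp t] psh_pull_at[OF kX p' t]
        psh_pull_at[OF kY Gp qfunctor_carrier[OF F t]] dpsh_mult_index_natural[OF f t] .
  qed
  then have "qcat_le Q (PSh Q (CoPSh Q X)) (dpsh_mult Q X p)
      (psh_pull Q (CoPSh Q X) (CoPSh Q Y) ?F (dpsh_mult Q Y ?p))"
    using mp carrier_psh_pull[OF F mGp]
    by (simp add: qcat_le_PSh_iff[OF is_qcat_CoPSh[OF X]] dpsh_mult_eq)
  then show ?thesis
    using qcat_le_psh_push_iff[OF F mp mGp] by (simp add: dpsh_mult_eq dpsh_map_def DPSh_def)
qed

end

section \<open>The distributive law\<close>

context quantaloid
begin

text \<open>The functor \<open>R\<^sub>X\<close>, right adjoint to \<open>D y\<^sub>X\<close>.\<close>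

definition yoneda_radj :: "('a, 'o, 'm) qcat \<Rightarrow> (('a, 'o, 'm) psh, 'o, 'm) dpsh \<Rightarrow> ('a, 'o, 'm) dpsh"
  where "yoneda_radj X =
    psh_pull Q (CoPSh Q X) (CoPSh Q (PSh Q X)) (copsh_push Q X (PSh Q X) (yoneda X))"

lemma qfunctor_yoneda_radj:
  "is_qcat Q X \<Longrightarrow> qfunctor Q (DPSh Q (PSh Q X)) (DPSh Q X) (yoneda_radj X)"
  unfolding yoneda_radj_def DPSh_def
  by (rule qfunctor_psh_pull[OF qfunctor_copsh_push[OF qfunctor_yoneda]])

lemma hm_dpsh_map_yoneda:
  assumes X: "is_qcat Q X" and p: "p \<in> carrier (DPSh Q X)" and q: "q \<in> carrier (DPSh Q (PSh Q X))"
  shows "hm (DPSh Q (PSh Q X)) (dpsh_map Q X (PSh Q X) (yoneda X) p) q =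
    hm (DPSh Q X) p (yoneda_radj X q)"
  using psh_push_adjoint_pull[OF qfunctor_copsh_push[OF qfunctor_yoneda[OF X]]] p q
  by (simp add: dpsh_map_def yoneda_radj_def DPSh_def)

lemma le_yoneda_radj_iff:
  assumes X: "is_qcat Q X" and p: "p \<in> carrier (DPSh Q X)" and q: "q \<in> carrier (DPSh Q (PSh Q X))"
  shows "qcat_le Q (DPSh Q (PSh Q X)) (dpsh_map Q X (PSh Q X) (yoneda X) p) q \<longleftrightarrow>
    qcat_le Q (DPSh Q X) p (yoneda_radj X q)"
  using qcat_le_psh_push_iff[OF qfunctor_copsh_push[OF qfunctor_yoneda[OF X]]] p q
  by (simp add: dpsh_map_def yoneda_radj_def DPSh_def)

lemma yoneda_radj_counit:
  assumes X: "is_qcat Q X" and q: "q \<in> carrier (DPSh Q (PSh Q X))"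
  shows "qcat_le Q (DPSh Q (PSh Q X)) (dpsh_map Q X (PSh Q X) (yoneda X) (yoneda_radj X q)) q"
  using le_yoneda_radj_iff[OF X _ q] qfunctor_carrier[OF qfunctor_yoneda_radj[OF X] q]
    qcat_le_refl[OF is_qcat_DPSh[OF X]] by blast

text \<open>The Yoneda embedding is fully faithful, hence so is the direct image of copresheaves along it, and
  along a fully faithful functor the inverse image of presheaves undoes the direct image.\<close>

lemma yoneda_radj_section:
  assumes X: "is_qcat Q X" and p: "p \<in> carrier (DPSh Q X)"
  shows "yoneda_radj X (dpsh_map Q X (PSh Q X) (yoneda X) p) = p"
  using psh_pull_push_fully_faithful[OF qfunctor_copsh_push[OF qfunctor_yoneda[OF X]]
      fully_faithful_copsh_push[OF qfunctor_yoneda[OF X] fully_faithful_yoneda[OF X]]] p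
  by (simp add: yoneda_radj_def dpsh_map_def DPSh_def)

text \<open>The presheaf \<open>p \<mapsto> 1\<^sup>*(D y\<^sub>X p, q)\<close> is representable since \<open>D y\<^sub>X\<close> has a right adjoint.\<close>

lemma Lam_eq:
  assumes X: "is_qcat Q X" and q: "q \<in> carrier (DPSh Q (PSh Q X))"
  shows "Lam Q X q = yoneda (DPSh Q X) (yoneda_radj X q)"
proof -
  have "tp (DPSh Q (PSh Q X)) q = tp (DPSh Q X) (yoneda_radj X q)"
    by (simp add: DPSh_def yoneda_radj_def)
  moreover have "(\<lambda>p\<in>carrier (DPSh Q X). \<lambda>_::unit. graph (DPSh Q X) (DPSh Q (PSh Q X))
        (dpsh_map Q X (PSh Q X) (yoneda X)) p q) =
      (\<lambda>p\<in>carrier (DPSh Q X). \<lambda>_. hm (DPSh Q X) p (yoneda_radj X q))"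
    by (rule restrict_ext) (simp add: graph_def q hm_dpsh_map_yoneda[OF X _ q])
  ultimately show ?thesis by (simp add: Lam_def lvec_def yoneda_def)
qed

lemma qfunctor_Lam:
  assumes X: "is_qcat Q X"
  shows "qfunctor Q (DPSh Q (PSh Q X)) (PSh Q (DPSh Q X)) (Lam Q X)"
proof -
  have "qfunctor Q (DPSh Q (PSh Q X)) (PSh Q (DPSh Q X)) (yoneda (DPSh Q X) \<circ> yoneda_radj X)"
    by (rule qfunctor_comp[OF qfunctor_yoneda_radj[OF X] qfunctor_yoneda[OF is_qcat_DPSh[OF X]]])
  then show ?thesis by (simp add: qfunctor_def Lam_eq[OF X] Pi_iff)
qed

lemma Lam_eq_psh_pull_yoneda:
  assumes X: "is_qcat Q X" and q: "q \<in> carrier (DPSh Q (PSh Q X))"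
  shows "Lam Q X q = psh_pull Q (DPSh Q X) (DPSh Q (PSh Q X))
    (dpsh_map Q X (PSh Q X) (yoneda X)) (yoneda (DPSh Q (PSh Q X)) q)" (is "_ = ?R")
proof -
  note Dy = qfunctor_dpsh_map[OF qfunctor_yoneda[OF X]] and PX = is_qcat_DPSh[OF is_qcat_PSh[OF X]]
  note yq = carrier_yoneda[OF PX q] and D = is_qcat_DPSh[OF X]
  show ?thesis
  proof (rule PSh_eqI[OF D qfunctor_carrier[OF qfunctor_Lam[OF X] q] carrier_psh_pull[OF Dy yq]])
    show "fst (Lam Q X q) = fst ?R" by (simp add: Lam_def lvec_def)
    show "Lam Q X q \<bullet> p = ?R \<bullet> p" if p: "p \<in> carrier (DPSh Q X)" for p
      using psh_pull_at[OF Dy yq p] qfunctor_carrier[OF Dy p] p q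
      by (simp add: Lam_def lvec_def graph_def)
  qed
qed

lemma Lam_flat:
  assumes X: "is_qcat Q X" and p: "p \<in> carrier (DPSh Q X)"
  shows "Lam Q X (dpsh_map Q X (PSh Q X) (yoneda X) p) = yoneda (DPSh Q X) p"
  using Lam_eq[OF X qfunctor_carrier[OF qfunctor_dpsh_map[OF qfunctor_yoneda[OF X]] p]]
    yoneda_radj_section[OF X p] by simp

text \<open>Direct image along \<open>D f\<close> preserves the representable \<open>\<Lambda>\<^sub>X(p)\<close>, so it suffices to compare the
  representing objects.  The inequality \<open>D f \<cdot> R\<^sub>X \<le> R\<^sub>Y \<cdot> D f\<^sub>!\<close> transposes to
  \<open>D(y\<^sub>Y \<cdot> f) \<cdot> R\<^sub>X \<le> D f\<^sub>!\<close>, where \<open>y\<^sub>Y \<cdot> f = f\<^sub>! \<cdot> y\<^sub>X\<close> brings in the counit \<open>D y\<^sub>X \<cdot> R\<^sub>X \<le> 1\<close>.\<close>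

lemma Lam_lax_natural:
  assumes f: "qfunctor Q X Y f" and p: "p \<in> carrier (DPSh Q (PSh Q X))"
  shows "qcat_le Q (PSh Q (DPSh Q Y))
    (psh_push Q (DPSh Q X) (DPSh Q Y) (dpsh_map Q X Y f) (Lam Q X p))
    (Lam Q Y (dpsh_map Q (PSh Q X) (PSh Q Y) (psh_push Q X Y f) p))"
proof -
  let ?D = "dpsh_map Q X Y f" and ?E = "dpsh_map Q (PSh Q X) (PSh Q Y) (psh_push Q X Y f)"
  let ?yX = "dpsh_map Q X (PSh Q X) (yoneda X)" and ?yY = "dpsh_map Q Y (PSh Q Y) (yoneda Y)"
  note X = qfunctor_dom[OF f] and Y = qfunctor_cod[OF f]
  note D = qfunctor_dpsh_map[OF f] and P = qfunctor_psh_push[OF f]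
  note E = qfunctor_dpsh_map[OF P] and yX = qfunctor_yoneda[OF X] and yY = qfunctor_yoneda[OF Y]
  note Ep = qfunctor_carrier[OF E p] and Rp = qfunctor_carrier[OF qfunctor_yoneda_radj[OF X] p]
  note DRp = qfunctor_carrier[OF D Rp]
  have "?yY (?D (yoneda_radj X p)) = dpsh_map Q X (PSh Q Y) (yoneda Y \<circ> f) (yoneda_radj X p)"
    using dpsh_map_comp[OF f yY Rp] by simp
  also have "dpsh_map Q X (PSh Q Y) (yoneda Y \<circ> f) = dpsh_map Q X (PSh Q Y) (psh_push Q X Y f \<circ> yoneda X)"
    by (rule dpsh_map_cong) (simp add: psh_push_yoneda[OF f])
  also have "\<dots> (yoneda_radj X p) = ?E (?yX (yoneda_radj X p))"
    by (rule dpsh_map_comp[OF yX P Rp])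
  finally have "qcat_le Q (DPSh Q (PSh Q Y)) (?yY (?D (yoneda_radj X p))) (?E p)"
    using qfunctor_mono[OF E yoneda_radj_counit[OF X p]] by simp
  then have "qcat_le Q (DPSh Q Y) (?D (yoneda_radj X p)) (yoneda_radj Y (?E p))"
    using le_yoneda_radj_iff[OF Y DRp Ep] by simp
  then show ?thesis
    using qfunctor_mono[OF qfunctor_yoneda[OF is_qcat_DPSh[OF Y]]]
    by (simp add: Lam_eq[OF X p] Lam_eq[OF Y Ep] psh_push_yoneda[OF D Rp])
qed

text \<open>The left side collapses to \<open>\<Lambda>\<^sub>X \<cdot> R\<^sub>P\<^sub>X\<close>, as \<open>\<Lambda>\<^sub>P\<^sub>X\<close> takes representable values, which the direct
  image preserves and the multiplication evaluates.  Then \<open>s\<^sub>X \<cdot> y\<^sub>P\<^sub>X = 1\<close> and the counit of the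
  adjunction give \<open>R\<^sub>P\<^sub>X \<le> D s\<^sub>X\<close>.\<close>

lemma Lam_psh_mult:
  assumes X: "is_qcat Q X" and p: "p \<in> carrier (DPSh Q (PSh Q (PSh Q X)))"
  shows "qcat_le Q (PSh Q (DPSh Q X))
    (psh_mult Q (DPSh Q X) (psh_push Q (DPSh Q (PSh Q X)) (PSh Q (DPSh Q X)) (Lam Q X)
      (Lam Q (PSh Q X) p)))
    (Lam Q X (dpsh_map Q (PSh Q (PSh Q X)) (PSh Q X) (psh_mult Q X) p))"
proof -
  let ?R = "yoneda_radj (PSh Q X) p" and ?s = "dpsh_map Q (PSh Q (PSh Q X)) (PSh Q X) (psh_mult Q X)"
  note PX = is_qcat_PSh[OF X] and s = qfunctor_psh_mult[OF X]
  note y = qfunctor_yoneda[OF PX] and L = qfunctor_Lam[OF X]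
  note R = qfunctor_carrier[OF qfunctor_yoneda_radj[OF PX] p]
  have "?s (dpsh_map Q (PSh Q X) (PSh Q (PSh Q X)) (yoneda (PSh Q X)) ?R) =
      dpsh_map Q (PSh Q X) (PSh Q X) (psh_mult Q X \<circ> yoneda (PSh Q X)) ?R"
    using dpsh_map_comp[OF y s R] by simp
  also have "dpsh_map Q (PSh Q X) (PSh Q X) (psh_mult Q X \<circ> yoneda (PSh Q X)) =
      dpsh_map Q (PSh Q X) (PSh Q X) (\<lambda>x. x)"
    by (rule dpsh_map_cong) (simp add: psh_mult_yoneda[OF X])
  finally have "qcat_le Q (DPSh Q (PSh Q X)) ?R (?s p)"
    using qfunctor_mono[OF qfunctor_dpsh_map[OF s] yoneda_radj_counit[OF PX p]] dpsh_map_id[OF PX R]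
    by simp
  then have "qcat_le Q (PSh Q (DPSh Q X)) (Lam Q X ?R) (Lam Q X (?s p))"
    by (rule qfunctor_mono[OF L])
  then show ?thesis
    by (simp add: Lam_eq[OF PX p] psh_push_yoneda[OF L R]
        psh_mult_yoneda[OF is_qcat_DPSh[OF X] qfunctor_carrier[OF L R]])
qed

text \<open>Here the left side need not be representable.  Transposed across the direct image along \<open>e\<^sub>X\<close> and
  evaluated at \<open>x\<close>, the claim is \<open>p(x) \<preceq> 1\<^sup>*(D y\<^sub>X(e\<^sub>X x), e\<^sub>P\<^sub>X p)\<close>.  By naturality of \<open>e\<close> the right side
  is \<open>1\<^sup>*(e\<^sub>P\<^sub>X(y\<^sub>X x), e\<^sub>P\<^sub>X p)\<close>, and \<open>p(x)\<close> is \<open>1\<^sup>*(y\<^sub>X x, p)\<close> by the Yoneda lemma.\<close>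

lemma Lam_dpsh_unit:
  assumes X: "is_qcat Q X" and p: "p \<in> carrier (PSh Q X)"
  shows "qcat_le Q (PSh Q (DPSh Q X)) (psh_push Q X (DPSh Q X) (dpsh_unit Q X) p)
    (Lam Q X (dpsh_unit Q (PSh Q X) p))"
proof -
  let ?e = "dpsh_unit Q X" and ?q = "dpsh_unit Q (PSh Q X) p"
  note PX = is_qcat_PSh[OF X] and y = qfunctor_yoneda[OF X] and e = qfunctor_dpsh_unit[OF X]
  note eP = qfunctor_dpsh_unit[OF PX]
  note q = qfunctor_carrier[OF eP p]
  note Lq = qfunctor_carrier[OF qfunctor_Lam[OF X] q]
  have "p \<bullet> x \<preceq> psh_pull Q X (DPSh Q X) ?e (Lam Q X ?q) \<bullet> x" if x: "x \<in> carrier X" for x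
  proof -
    note ex = qfunctor_carrier[OF e x]
    have "psh_pull Q X (DPSh Q X) ?e (Lam Q X ?q) \<bullet> x = hm (DPSh Q X) (?e x) (yoneda_radj X ?q)"
      using psh_pull_at[OF e Lq x] Lam_eq[OF X q] ex by simp
    also have "\<dots> = hm (DPSh Q (PSh Q X)) (dpsh_unit Q (PSh Q X) (yoneda X x)) ?q"
      using hm_dpsh_map_yoneda[OF X ex q] dpsh_map_unit[OF y x] by simp
    finally show ?thesis
      using qfunctor_hm[OF eP carrier_yoneda[OF X x] p] Yoneda[OF X x p] by simp
  qed
  moreover have "fst (Lam Q X ?q) = fst p" using qfunctor_tp[OF eP p]
    by (simp add: Lam_def lvec_def DPSh_def)
  ultimately have "qcat_le Q (PSh Q X) p (psh_pull Q X (DPSh Q X) ?e (Lam Q X ?q))"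
    using p carrier_psh_pull[OF e Lq] by (simp add: qcat_le_PSh_iff[OF X])
  then show ?thesis using qcat_le_psh_push_iff[OF e p Lq] by blast
qed

text \<open>Flatness at \<open>D X\<close> cancels the Yoneda embedding in \<open>\<Lambda>\<^sub>X = y\<^sub>D\<^sub>X \<cdot> R\<^sub>X\<close> against the outer \<open>\<Lambda>\<^sub>D\<^sub>X\<close>, so
  that the left side is represented by \<open>m\<^sub>X(D R\<^sub>X p)\<close>.  This is compared with \<open>R\<^sub>X(m\<^sub>P\<^sub>X p)\<close> by
  transposition, lax naturality of \<open>m\<close> and the image under \<open>D\<close> of the counit \<open>D y\<^sub>X \<cdot> R\<^sub>X \<le> 1\<close>.\<close>

lemma Lam_dpsh_mult:
  assumes X: "is_qcat Q X" and p: "p \<in> carrier (DPSh Q (DPSh Q (PSh Q X)))"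
  shows "qcat_le Q (PSh Q (DPSh Q X))
    (psh_push Q (DPSh Q (DPSh Q X)) (DPSh Q X) (dpsh_mult Q X)
      (Lam Q (DPSh Q X) (dpsh_map Q (DPSh Q (PSh Q X)) (PSh Q (DPSh Q X)) (Lam Q X) p)))
    (Lam Q X (dpsh_mult Q (PSh Q X) p))"
proof -
  let ?R = "yoneda_radj X" and ?y = "dpsh_map Q X (PSh Q X) (yoneda X)"
  let ?Rp = "dpsh_map Q (DPSh Q (PSh Q X)) (DPSh Q X) ?R p"
  let ?yy = "dpsh_map Q (DPSh Q X) (DPSh Q (PSh Q X)) ?y"
  note PX = is_qcat_PSh[OF X] and D = is_qcat_DPSh[OF X] and DP = is_qcat_DPSh[OF is_qcat_PSh[OF X]]
  note R = qfunctor_yoneda_radj[OF X] and y = qfunctor_yoneda[OF X]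
  note Dy = qfunctor_dpsh_map[OF y] and m = qfunctor_dpsh_mult[OF X] and mP = qfunctor_dpsh_mult[OF PX]
  note Rp = qfunctor_carrier[OF qfunctor_dpsh_map[OF R] p]
  have "dpsh_map Q (DPSh Q (PSh Q X)) (PSh Q (DPSh Q X)) (Lam Q X) =
      dpsh_map Q (DPSh Q (PSh Q X)) (PSh Q (DPSh Q X)) (yoneda (DPSh Q X) \<circ> ?R)"
    by (rule dpsh_map_cong) (simp add: Lam_eq[OF X])
  then have "dpsh_map Q (DPSh Q (PSh Q X)) (PSh Q (DPSh Q X)) (Lam Q X) p =
      dpsh_map Q (DPSh Q X) (PSh Q (DPSh Q X)) (yoneda (DPSh Q X)) ?Rp"
    using dpsh_map_comp[OF R qfunctor_yoneda[OF D] p] by simp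
  then have lhs: "psh_push Q (DPSh Q (DPSh Q X)) (DPSh Q X) (dpsh_mult Q X)
      (Lam Q (DPSh Q X) (dpsh_map Q (DPSh Q (PSh Q X)) (PSh Q (DPSh Q X)) (Lam Q X) p)) =
      yoneda (DPSh Q X) (dpsh_mult Q X ?Rp)"
    by (simp add: Lam_flat[OF D Rp] psh_push_yoneda[OF m Rp])
  have "qfun_le Q (DPSh Q (PSh Q X)) (DPSh Q (PSh Q X)) (?y \<circ> ?R) (\<lambda>q. q)"
    using yoneda_radj_counit[OF X] by (simp add: qfun_le_def)
  then have "qcat_le Q (DPSh Q (DPSh Q (PSh Q X))) (?yy ?Rp) p"
    using dpsh_map_mono[OF qfunctor_comp[OF R Dy] qfunctor_id[OF DP] _ p]
      dpsh_map_comp[OF R Dy p] dpsh_map_id[OF DP p] by simp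
  then have "qcat_le Q (DPSh Q (PSh Q X)) (dpsh_mult Q (PSh Q X) (?yy ?Rp)) (dpsh_mult Q (PSh Q X) p)"
    by (rule qfunctor_mono[OF mP])
  then have "qcat_le Q (DPSh Q (PSh Q X)) (?y (dpsh_mult Q X ?Rp)) (dpsh_mult Q (PSh Q X) p)"
    by (rule qcat_le_trans[OF DP dpsh_mult_lax_natural[OF y Rp]])
  then have "qcat_le Q (DPSh Q X) (dpsh_mult Q X ?Rp) (?R (dpsh_mult Q (PSh Q X) p))"
    using le_yoneda_radj_iff[OF X qfunctor_carrier[OF m Rp] qfunctor_carrier[OF mP p]] by blast
  then show ?thesis
    using qfunctor_mono[OF qfunctor_yoneda[OF D]] lhs
    by (simp add: Lam_eq[OF X qfunctor_carrier[OF mP p]])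
qed

end

theorem proposition6p1:
  fixes Q :: "('o, 'm) quantaloid"
  assumes "quantaloid Q"
  shows
    \<comment> \<open>the components are functors, given by any of the three formulas\<close>
    "(\<forall>X :: ('a, 'o, 'm) qcat. is_qcat Q X \<longrightarrow>
        qfunctor Q (DPSh Q (PSh Q X)) (PSh Q (DPSh Q X)) (Lam Q X) \<and>
        qfun_eq (DPSh Q (PSh Q X)) (Lam Q X)
          (psh_pull Q (DPSh Q X) (DPSh Q (PSh Q X)) (dpsh_map Q X (PSh Q X) (yoneda X))
            \<circ> yoneda (DPSh Q (PSh Q X))) \<and>
        qfun_eq (DPSh Q (PSh Q X)) (Lam Q X)
          (yoneda (DPSh Q X)
            \<circ> psh_pull Q (CoPSh Q X) (CoPSh Q (PSh Q X)) (copsh_push Q X (PSh Q X) (yoneda X))))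
     \<and>
     \<comment> \<open>(a)\<close>
     (\<forall>(X :: ('a, 'o, 'm) qcat) (Y :: ('b, 'o, 'm) qcat) f. qfunctor Q X Y f \<longrightarrow>
        qfun_le Q (DPSh Q (PSh Q X)) (PSh Q (DPSh Q Y))
          (psh_push Q (DPSh Q X) (DPSh Q Y) (dpsh_map Q X Y f) \<circ> Lam Q X)
          (Lam Q Y \<circ> dpsh_map Q (PSh Q X) (PSh Q Y) (psh_push Q X Y f)))
     \<and>
     (\<forall>X :: ('a, 'o, 'm) qcat. is_qcat Q X \<longrightarrow>
        \<comment> \<open>(b)\<close>
        qfun_le Q (DPSh Q X) (PSh Q (DPSh Q X))
          (yoneda (DPSh Q X))
          (Lam Q X \<circ> dpsh_map Q X (PSh Q X) (yoneda X)) \<and>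
        \<comment> \<open>(c)\<close>
        qfun_le Q (DPSh Q (PSh Q (PSh Q X))) (PSh Q (DPSh Q X))
          (psh_mult Q (DPSh Q X)
            \<circ> psh_push Q (DPSh Q (PSh Q X)) (PSh Q (DPSh Q X)) (Lam Q X)
            \<circ> Lam Q (PSh Q X))
          (Lam Q X \<circ> dpsh_map Q (PSh Q (PSh Q X)) (PSh Q X) (psh_mult Q X)) \<and>
        \<comment> \<open>(d)\<close>
        qfun_le Q (PSh Q X) (PSh Q (DPSh Q X))
          (psh_push Q X (DPSh Q X) (dpsh_unit Q X))
          (Lam Q X \<circ> dpsh_unit Q (PSh Q X)) \<and>
        \<comment> \<open>(e)\<close>
        qfun_le Q (DPSh Q (DPSh Q (PSh Q X))) (PSh Q (DPSh Q X))
          (psh_push Q (DPSh Q (DPSh Q X)) (DPSh Q X) (dpsh_mult Q X)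
            \<circ> Lam Q (DPSh Q X)
            \<circ> dpsh_map Q (DPSh Q (PSh Q X)) (PSh Q (DPSh Q X)) (Lam Q X))
          (Lam Q X \<circ> dpsh_mult Q (PSh Q X)) \<and>
        \<comment> \<open>flatness\<close>
        qfun_eq (DPSh Q X)
          (yoneda (DPSh Q X))
          (Lam Q X \<circ> dpsh_map Q X (PSh Q X) (yoneda X)))"
proof (intro conjI allI impI)
  interpret quantaloid Q by (rule assms)
  fix X :: "('a, 'o, 'm) qcat"
  assume X: "is_qcat Q X"
  show "qfunctor Q (DPSh Q (PSh Q X)) (PSh Q (DPSh Q X)) (Lam Q X)"
    by (rule qfunctor_Lam[OF X])
  show "qfun_eq (DPSh Q (PSh Q X)) (Lam Q X)
      (psh_pull Q (DPSh Q X) (DPSh Q (PSh Q X)) (dpsh_map Q X (PSh Q X) (yoneda X))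
        \<circ> yoneda (DPSh Q (PSh Q X)))"
    unfolding qfun_eq_def o_apply using Lam_eq_psh_pull_yoneda[OF X] by blast
  show "qfun_eq (DPSh Q (PSh Q X)) (Lam Q X)
      (yoneda (DPSh Q X)
        \<circ> psh_pull Q (CoPSh Q X) (CoPSh Q (PSh Q X)) (copsh_push Q X (PSh Q X) (yoneda X)))"
    unfolding qfun_eq_def o_apply using Lam_eq[OF X] unfolding yoneda_radj_def by blast
  show "qfun_le Q (DPSh Q X) (PSh Q (DPSh Q X)) (yoneda (DPSh Q X))
      (Lam Q X \<circ> dpsh_map Q X (PSh Q X) (yoneda X))"
    unfolding qfun_le_def o_apply
    by (simp add: Lam_flat[OF X] qcat_le_refl is_qcat_PSh is_qcat_DPSh[OF X] carrier_yoneda)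
  show "qfun_eq (DPSh Q X) (yoneda (DPSh Q X)) (Lam Q X \<circ> dpsh_map Q X (PSh Q X) (yoneda X))"
    unfolding qfun_eq_def o_apply by (simp add: Lam_flat[OF X])
  show "qfun_le Q (DPSh Q (PSh Q (PSh Q X))) (PSh Q (DPSh Q X))
      (psh_mult Q (DPSh Q X) \<circ> psh_push Q (DPSh Q (PSh Q X)) (PSh Q (DPSh Q X)) (Lam Q X)
        \<circ> Lam Q (PSh Q X))
      (Lam Q X \<circ> dpsh_map Q (PSh Q (PSh Q X)) (PSh Q X) (psh_mult Q X))"
    unfolding qfun_le_def o_apply using Lam_psh_mult[OF X] by blast
  show "qfun_le Q (PSh Q X) (PSh Q (DPSh Q X)) (psh_push Q X (DPSh Q X) (dpsh_unit Q X))
      (Lam Q X \<circ> dpsh_unit Q (PSh Q X))"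
    unfolding qfun_le_def o_apply using Lam_dpsh_unit[OF X] by blast
  show "qfun_le Q (DPSh Q (DPSh Q (PSh Q X))) (PSh Q (DPSh Q X))
      (psh_push Q (DPSh Q (DPSh Q X)) (DPSh Q X) (dpsh_mult Q X) \<circ> Lam Q (DPSh Q X)
        \<circ> dpsh_map Q (DPSh Q (PSh Q X)) (PSh Q (DPSh Q X)) (Lam Q X))
      (Lam Q X \<circ> dpsh_mult Q (PSh Q X))"
    unfolding qfun_le_def o_apply using Lam_dpsh_mult[OF X] by blast
next
  interpret quantaloid Q by (rule assms)
  fix X :: "('a, 'o, 'm) qcat" and Y :: "('b, 'o, 'm) qcat" and f
  assume f: "qfunctor Q X Y f"
  show "qfun_le Q (DPSh Q (PSh Q X)) (PSh Q (DPSh Q Y))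
      (psh_push Q (DPSh Q X) (DPSh Q Y) (dpsh_map Q X Y f) \<circ> Lam Q X)
      (Lam Q Y \<circ> dpsh_map Q (PSh Q X) (PSh Q Y) (psh_push Q X Y f))"
    unfolding qfun_le_def o_apply using Lam_lax_natural[OF f] by blast
qed

end
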